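(* Let $F=(f,g):\mathbb{R}^2\to\mathbb{R}^2$ be a polynomial map whose Jacobian determinant vanishes nowhere on $\mathbb{R}^2$ and such that $F(0,0)=(0,0)$. Define the polynomial $I(x,y)=f^2(x,y)+g^2(x,y)$. Then $F$ is globally injective (i.e. injective on $\mathbb{R}^2$) if and only if $$\lim_{|x|+|y|\to+\infty} I(x,y)=+\infty.$$ *)

theory Defs
  imports "HOL-Analysis.Analysis"
begin

end

(*
  If I tends to infinity, then F is a proper local homeomorphism of the plane, hence a covering of the
  simply connected plane by itself, hence injective.

  Conversely, an injective F is a homeomorphism onto an open set U, and it suffices to show that U is the
  whole plane: then the inverse is continuous and preimages of bounded sets are bounded.  After a
  substitution x -> x + y^n the component f is monic in y up to a constant, and
  M(a,b,z) = prod (b - g(z,y)), over the complex roots y of f(z,y) = a, is a polynomial in a, b, z by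
  Newton's identities.  For a fixed point q = (a,b), non-real roots contribute a nonnegative factor, so
  the sign of M(q,z) can only change where z passes the abscissa of a solution of F = q.  Dividing M by
  its content with respect to z gives M' such that, whenever M'(q,z) is not identically zero, its degree
  in z is odd if q lies in U and even otherwise.

  Let E be the complement of U.  Generically the degree is that of M', which is therefore odd, so E lies
  in the zero set of the leading coefficient.  Since U is simply connected, E is infinite unless it is
  empty, and then some prime factor p of the leading coefficient vanishes at infinitely many points of E.
  As M' is primitive, on p = 0 the degree has a constant value k up to finitely many points; these points
  of E show that k is even, so U meets p = 0 in a finite set only.  As U minus a finite set is connected
  and dense, p does not change sign in the plane, so its zeros are critical, and p divides its own
  partial derivatives, which is absurd.
*)
theory Submission
  imports Defs "HOL-Complex_Analysis.Complex_Analysis" "HOL-Computational_Algebra.Field_as_Ring" "HOL-Computational_Algebra.Computational_Algebra"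
begin

section \<open>Power sums and elementary symmetric functions\<close>

definition psum :: "'a::comm_ring_1 multiset \<Rightarrow> nat \<Rightarrow> 'a" where
  "psum A k = (\<Sum>x\<in>#A. x ^ k)"

text \<open>The reversed monic polynomial with root multiset \<open>A\<close>: its k-th coefficient
  is, up to the sign (-1)^k, the k-th elementary symmetric function. As a power series it can be
  compared with the generating series of the power sums.\<close>

definition root_fps :: "'a::field multiset \<Rightarrow> 'a fps" where
  "root_fps A = (\<Prod>x\<in>#A. (1 - fps_const x * fps_X))"

text \<open>Logarithmic derivative of the product, cleared of denominators: the factor 1 - x X
  contributes -x / (1 - x X), a geometric series in the powers of x.\<close>

lemma fps_deriv_root_fps:
  "fps_deriv (root_fps A) = - root_fps A * Abs_fps (\<lambda>k. psum A (Suc k))"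
proof (induction A)
  case empty
  then show ?case
    by (simp add: root_fps_def psum_def fps_eq_iff)
next
  case (add x A)
  let ?L = "1 - fps_const x * fps_X"
  let ?S = "Abs_fps (\<lambda>k. psum A (Suc k))"
  let ?T = "Abs_fps (\<lambda>k. x ^ Suc k)"
  have T: "?L * ?T = fps_const x"
  proof (rule fps_ext)
    fix n show "(?L * ?T) $ n = fps_const x $ n"
      by (cases n) (simp_all add: left_diff_distrib mult.assoc)
  qed
  have S: "Abs_fps (\<lambda>k. psum (add_mset x A) (Suc k)) = ?T + ?S"
    by (simp add: psum_def fps_eq_iff)
  have R: "root_fps (add_mset x A) = ?L * root_fps A"
    by (simp add: root_fps_def)
  have D: "fps_deriv ?L = - fps_const x"
    by simp
  have "fps_deriv (root_fps (add_mset x A)) = - fps_const x * root_fps A + ?L * fps_deriv (root_fps A)"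
    unfolding R fps_deriv_mult D by simp
  also have "\<dots> = - (?L * ?T) * root_fps A - ?L * (root_fps A * ?S)"
    unfolding T add.IH by simp
  also have "\<dots> = - (?L * root_fps A) * (?T + ?S)"
    by (simp add: algebra_simps)
  finally show ?case unfolding S R .
qed

text \<open>Coefficient k of \<open>fps_deriv_root_fps\<close>. The identity can be solved for the
  last power sum and, in characteristic 0, for the last coefficient; both directions occur
  below.\<close>

lemma newton_identity:
  fixes A :: "'a::field_char_0 multiset"
  shows "of_nat (Suc k) * root_fps A $ Suc k = - (\<Sum>i\<le>k. root_fps A $ i * psum A (Suc (k - i)))"
proof -
  have "fps_deriv (root_fps A) $ k = (- root_fps A * Abs_fps (\<lambda>k. psum A (Suc k))) $ k"
    by (simp only: fps_deriv_root_fps)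
  then show ?thesis
    by (simp add: fps_mult_nth atLeast0AtMost sum_negf)
qed

lemma root_fps_0 [simp]: "root_fps A $ 0 = 1"
  by (induction A) (simp_all add: root_fps_def)

lemma root_fps_eq_poly: "root_fps A = fps_of_poly (reflect_poly (\<Prod>x\<in>#A. [:-x, 1:]))"
proof (induction A)
  case (add x A)
  have "fps_of_poly (reflect_poly [:-x, 1:]) = 1 - fps_const x * fps_X"
    by (cases "x = 0") (simp_all add: reflect_poly_def reflect_poly_pCons fps_of_poly_pCons  cCons_def algebra_simps)
  then show ?case using add
    by (simp add: root_fps_def reflect_poly_mult fps_of_poly_mult del: mult_pCons_left)
qed (simp add: root_fps_def)

lemma degree_prod_mset_linear [simp]:
  "degree (\<Prod>x\<in>#A. [:-x, 1::'a::field:]) = size A"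
proof (induction A)
  case (add x A)
  have "(\<Prod>x\<in>#A. [:-x, 1:]) \<noteq> (0::'a poly)"
    by (auto simp: prod_mset_zero_iff)
  with add show ?case by (simp add: degree_mult_eq del: mult_pCons_left)
qed simp

lemma proots_prod_mset_linear: "proots (\<Prod>x\<in>#A. [:-x, 1::'a::field:]) = A"
proof (induction A)
  case (add x A)
  have "(\<Prod>x\<in>#A. [:-x, 1:]) \<noteq> (0::'a poly)"
    by (auto simp: prod_mset_zero_iff)
  with add show ?case by (simp add: proots_mult del: mult_pCons_left)
qed simp

lemma root_fps_nth:
  "root_fps A $ k = (if k \<le> size A then coeff (\<Prod>x\<in>#A. [:-x, 1:]) (size A - k) else 0)"
  by (auto simp: root_fps_eq_poly coeff_reflect_poly)

text \<open>Expands the monic polynomial with roots \<open>A\<close> at \<open>b\<close>, so that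
  the product becomes accessible through the coefficients that Newton's identities control.\<close>

lemma prod_diff_eq_sum_root_fps:
  fixes A :: "'a::field multiset"
  shows "(\<Prod>x\<in>#A. (b - x)) = (\<Sum>k\<le>size A. root_fps A $ k * b ^ (size A - k))"
proof -
  let ?p = "\<Prod>x\<in>#A. [:-x, 1:]"
  have "(\<Prod>x\<in>#A. (b - x)) = poly ?p b"
    by (induction A) (simp_all add: algebra_simps)
  also have "\<dots> = (\<Sum>i\<le>size A. coeff ?p i * b ^ i)"
    by (subst poly_altdef) simp
  also have "\<dots> = (\<Sum>k\<le>size A. coeff ?p (size A - k) * b ^ (size A - k))"
    by (rule sum.reindex_bij_witness[of _ "\<lambda>i. size A - i" "\<lambda>i. size A - i"]) auto
  finally show ?thesis by (simp add: root_fps_nth)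
qed

section \<open>Polynomial functions of three real variables\<close>

text \<open>An element of \<open>real poly poly poly\<close> is read as a polynomial in \<open>z\<close> over \<open>\<real>[a][b]\<close>, and one of
  \<open>real poly poly\<close> as a polynomial in its second argument (\<open>y\<close> or \<open>b\<close>) over the polynomials in the first.\<close>

definition eval3 :: "real poly poly poly \<Rightarrow> real \<Rightarrow> real \<Rightarrow> real \<Rightarrow> real" where
  "eval3 M a b z = poly (poly (poly M [:[:z:]:]) [:b:]) a"

text \<open>Values are complex because they will be computed from complex roots, but the witness has
  real coefficients.\<close>

definition is_poly3 :: "(real \<Rightarrow> real \<Rightarrow> real \<Rightarrow> complex) \<Rightarrow> bool" where
  "is_poly3 h \<longleftrightarrow> (\<exists>M. \<forall>a b z. h a b z = of_real (eval3 M a b z))"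

lemma is_poly3_const: "is_poly3 (\<lambda>a b z. of_real c)"
  unfolding is_poly3_def by (intro exI[of _ "[:[:[:c:]:]:]"]) (simp add: eval3_def)

lemma is_poly3_a: "is_poly3 (\<lambda>a b z. of_real a)"
  unfolding is_poly3_def by (intro exI[of _ "[:[:[:0,1:]:]:]"]) (simp add: eval3_def)

lemma is_poly3_b: "is_poly3 (\<lambda>a b z. of_real b)"
  unfolding is_poly3_def by (intro exI[of _ "[:[:0,1:]:]"]) (simp add: eval3_def)

lemma is_poly3_z: "is_poly3 (\<lambda>a b z. of_real z)"
  unfolding is_poly3_def by (intro exI[of _ "[:0,1:]"]) (simp add: eval3_def)

lemma is_poly3_add:
  assumes "is_poly3 h" "is_poly3 k" shows "is_poly3 (\<lambda>a b z. h a b z + k a b z)"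
proof -
  obtain M N where "\<And>a b z. h a b z = of_real (eval3 M a b z)" "\<And>a b z. k a b z = of_real (eval3 N a b z)"
    using assms unfolding is_poly3_def by metis
  then show ?thesis
    unfolding is_poly3_def by (intro exI[of _ "M + N"]) (simp add: eval3_def)
qed

lemma is_poly3_mult:
  assumes "is_poly3 h" "is_poly3 k" shows "is_poly3 (\<lambda>a b z. h a b z * k a b z)"
proof -
  obtain M N where "\<And>a b z. h a b z = of_real (eval3 M a b z)" "\<And>a b z. k a b z = of_real (eval3 N a b z)"
    using assms unfolding is_poly3_def by metis
  then show ?thesis
    unfolding is_poly3_def by (intro exI[of _ "M * N"]) (simp add: eval3_def)
qed

lemma is_poly3_sum:
  assumes "\<And>i. i \<in> I \<Longrightarrow> is_poly3 (h i)" shows "is_poly3 (\<lambda>a b z. \<Sum>i\<in>I. h i a b z)"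
  using assms
proof (induction I rule: infinite_finite_induct)
  case (insert i I)
  then show ?case by (simp add: is_poly3_add)
qed (use is_poly3_const[of 0] in simp_all)

lemma is_poly3_power: "is_poly3 h \<Longrightarrow> is_poly3 (\<lambda>a b z. h a b z ^ n)"
  by (induction n) (use is_poly3_const[of 1] in \<open>simp_all add: is_poly3_mult\<close>)

lemma is_poly3_minus: assumes "is_poly3 h" shows "is_poly3 (\<lambda>a b z. - h a b z)"
  using is_poly3_mult[OF is_poly3_const[of "-1"] assms] by simp

lemma is_poly3_poly_z: "is_poly3 (\<lambda>a b z. of_real (poly q z))"
proof (induction q)
  case (pCons c q)
  then show ?case
    using is_poly3_add[OF is_poly3_const[of c] is_poly3_mult[OF is_poly3_z]] by simp
qed (use is_poly3_const[of 0] in simp)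

text \<open>Newton's identity solved for the newest power sum. The size has to be constant because
  it is the power sum of index 0.\<close>

lemma is_poly3_psum:
  assumes root: "\<And>k. is_poly3 (\<lambda>a b z. root_fps (A a b z) $ k)"
      and size: "\<And>a b z. size (A a b z) = d"
  shows "is_poly3 (\<lambda>a b z. psum (A a b z) k)"
proof (induction k rule: less_induct)
  case (less k)
  show ?case
  proof (cases k)
    case 0
    have "psum (A a b z) k = of_real (real d)" for a b z
      by (simp add: psum_def 0 size)
    then show ?thesis using is_poly3_const[of "real d"] by simp
  next
    case (Suc n)
    have eq: "psum (A a b z) k = - (of_real (real k) * root_fps (A a b z) $ k) +
        - (\<Sum>i<n. root_fps (A a b z) $ Suc i * psum (A a b z) (n - i))" for a b z
    proof -
      have "of_nat k * root_fps (A a b z) $ k =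
          - (\<Sum>i\<le>n. root_fps (A a b z) $ i * psum (A a b z) (Suc (n - i)))"
        using newton_identity[of n "A a b z"] Suc by simp
      \<comment> \<open>The term i = 0 is the power sum of index \<open>k\<close> itself, since
        \<open>root_fps\<close> has constant coefficient 1; the other terms contain power sums of
        index at most n only.\<close>
      also have "(\<Sum>i\<le>n. root_fps (A a b z) $ i * psum (A a b z) (Suc (n - i)))
          = psum (A a b z) k + (\<Sum>i<n. root_fps (A a b z) $ Suc i * psum (A a b z) (Suc (n - Suc i)))"
        by (simp add: sum.atMost_shift Suc)
      also have "(\<Sum>i<n. root_fps (A a b z) $ Suc i * psum (A a b z) (Suc (n - Suc i)))
          = (\<Sum>i<n. root_fps (A a b z) $ Suc i * psum (A a b z) (n - i))"
        by (intro sum.cong) (auto simp: Suc_diff_Suc)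
      finally have e: "of_nat k * root_fps (A a b z) $ k = - (psum (A a b z) k +
          (\<Sum>i<n. root_fps (A a b z) $ Suc i * psum (A a b z) (n - i)))" .
      show ?thesis unfolding of_real_of_nat_eq e by simp
    qed
    show ?thesis
      unfolding eq
    proof (intro is_poly3_add is_poly3_minus is_poly3_mult is_poly3_const root is_poly3_sum)
      fix i assume "i \<in> {..<n}"
      then show "is_poly3 (\<lambda>a b z. psum (A a b z) (n - i))" using less Suc by simp
    qed
  qed
qed

text \<open>The converse direction: Newton's identity solved for the coefficient, dividing by
  \<open>k\<close>.\<close>

lemma is_poly3_root_fps:
  assumes psum: "\<And>k. is_poly3 (\<lambda>a b z. psum (A a b z) k)"
  shows "is_poly3 (\<lambda>a b z. root_fps (A a b z) $ k)"
proof (induction k rule: less_induct)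
  case (less k)
  show ?case
  proof (cases k)
    case 0
    then show ?thesis using is_poly3_const[of 1] by simp
  next
    case (Suc n)
    have eq: "root_fps (A a b z) $ k = of_real (- 1 / real k) *
        (\<Sum>i\<le>n. root_fps (A a b z) $ i * psum (A a b z) (Suc (n - i)))" for a b z
    proof -
      have "(\<Sum>i\<le>n. root_fps (A a b z) $ i * psum (A a b z) (Suc (n - i))) = - (of_nat k * root_fps (A a b z) $ k)"
        using newton_identity[of n "A a b z"] Suc by (simp only: minus_minus)
      moreover have "complex_of_nat k \<noteq> 0" using Suc by (simp del: of_nat_Suc)
      ultimately show ?thesis by simp
    qed
    show ?thesis
      unfolding eq
    proof (intro is_poly3_mult is_poly3_const psum is_poly3_sum)
      fix i assume "i \<in> {..n}"
      then show "is_poly3 (\<lambda>a b z. root_fps (A a b z) $ i)" using less Suc by simp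
    qed
  qed
qed

lemma map_poly_mult_hom:
  fixes p q :: "'a::comm_ring_1 poly"
  assumes "f 0 = 0" "\<And>x y. f (x + y) = f x + f y" "\<And>x y. f (x * y) = f x * f y"
  shows "map_poly f (p * q) = map_poly f p * map_poly f q"
proof (rule poly_eqI)
  fix n
  have sum: "f (sum h I) = (\<Sum>i\<in>I. f (h i))" for h and I :: "nat set"
    by (induction I rule: infinite_finite_induct) (simp_all add: assms)
  show "coeff (map_poly f (p * q)) n = coeff (map_poly f p * map_poly f q) n"
    by (simp add: coeff_map_poly assms coeff_mult sum)
qed

section \<open>The eliminant of two plane curves\<close>

text \<open>Restriction to the vertical line of abscissa \<open>z\<close>; over the complex numbers
  it splits into linear factors.\<close>

definition cspec :: "real poly poly \<Rightarrow> real \<Rightarrow> complex poly" where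
  "cspec P z = map_poly (\<lambda>q. complex_of_real (poly q z)) P"

lemma coeff_cspec [simp]: "coeff (cspec P z) n = of_real (poly (coeff P n) z)"
  by (simp add: cspec_def coeff_map_poly)

lemma cspec_mult: "cspec (P * Q) z = cspec P z * cspec Q z"
  unfolding cspec_def by (rule map_poly_mult_hom) simp_all

lemma cspec_power: "cspec (P ^ n) z = cspec P z ^ n"
  by (induction n) (simp_all add: cspec_mult, simp add: cspec_def)

lemma poly_cspec_of_real: "poly (cspec P z) (of_real y) = of_real (poly (poly P [:y:]) z)"
  by (induction P) (simp_all add: cspec_def map_poly_pCons)

lemma poly_cspec_cnj: "poly (cspec P z) (cnj y) = cnj (poly (cspec P z) y)"
  by (induction P) (simp_all add: cspec_def map_poly_pCons)

lemma degree_cspec: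
  assumes "lead_coeff P = [:c:]" "c \<noteq> 0"
  shows "degree (cspec P z) = degree P"
proof (rule antisym)
  show "degree (cspec P z) \<le> degree P"
    unfolding cspec_def by (rule map_poly_degree_leq)
  show "degree P \<le> degree (cspec P z)"
    using assms by (intro le_degree) simp
qed

definition shiftc :: "real poly poly \<Rightarrow> real \<Rightarrow> real poly poly" where
  "shiftc P a = P - [:[:a:]:]"

definition croots :: "real poly poly \<Rightarrow> real \<Rightarrow> real \<Rightarrow> complex multiset" where
  "croots P a z = proots (cspec (shiftc P a) z)"

lemma shiftc_lead:
  assumes "lead_coeff P = [:c:]" "degree P \<ge> 1"
  shows "degree (shiftc P a) = degree P" "lead_coeff (shiftc P a) = [:c:]"
proof -
  have "degree (- [:[:a:]:]) < degree P"
    using assms by simp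
  then show d: "degree (shiftc P a) = degree P"
    unfolding shiftc_def diff_conv_add_uminus by (rule degree_add_eq_left)
  show "lead_coeff (shiftc P a) = [:c:]"
    using assms unfolding d by (simp add: shiftc_def coeff_pCons split: nat.split)
qed

text \<open>A constant leading coefficient keeps the degree on every vertical line. Hence the number
  of roots depends neither on \<open>a\<close> nor on \<open>z\<close>, as the recursion for power
  sums requires.\<close>

lemma cspec_shiftc_factor:
  assumes "lead_coeff P = [:c:]" "c \<noteq> 0" "degree P \<ge> 1"
  shows "cspec (shiftc P a) z = smult (of_real c) (\<Prod>x\<in>#croots P a z. [:-x, 1:])"
    and "size (croots P a z) = degree P"
    and "cspec (shiftc P a) z \<noteq> 0"
proof -
  let ?p = "cspec (shiftc P a) z"
  have lc: "lead_coeff ?p = of_real c"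
  proof -
    have "degree ?p = degree (shiftc P a)"
      by (rule degree_cspec[OF shiftc_lead(2)]) (use assms in auto)
    then have "lead_coeff ?p = of_real (poly (lead_coeff (shiftc P a)) z)"
      by (simp only: coeff_cspec)
    then show ?thesis
      using assms by (simp only: shiftc_lead(2)) simp
  qed
  then show nz: "?p \<noteq> 0"
    by (metis assms(2) leading_coeff_0_iff of_real_eq_0_iff)
  obtain A where A: "?p = smult (lead_coeff ?p) (\<Prod>x\<in>#A. [:-x, 1:])"
    using alg_closed_imp_factorization[OF nz] by blast
  have "proots ?p = proots (\<Prod>x\<in>#A. [:-x, 1:])"
    using arg_cong[OF A, of proots] proots_smult leading_coeff_neq_0[OF nz] by metis
  also have "\<dots> = A" by (rule proots_prod_mset_linear)
  finally show "?p = smult (of_real c) (\<Prod>x\<in>#croots P a z. [:-x, 1:])"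
    using A lc by (simp add: croots_def)
  have "size (croots P a z) = degree ?p"
    unfolding croots_def by (rule size_proots_complex)
  then show "size (croots P a z) = degree P"
    using assms by (simp add: degree_cspec[OF shiftc_lead(2)] shiftc_lead(1))
qed

text \<open>Vieta: up to the factor 1 / c these are coefficients of P(z,y) - a in y, and
  \<open>a\<close> enters only the one of index 0.\<close>

lemma is_poly3_root_fps_croots:
  assumes "lead_coeff P = [:c:]" "c \<noteq> 0" "degree P \<ge> 1"
  shows "is_poly3 (\<lambda>a b z. root_fps (croots P a z) $ k)"
proof (cases "k \<le> degree P")
  case True
  let ?i = "degree P - k"
  have "root_fps (croots P a z) $ k
      = of_real (1 / c) * (of_real (poly (coeff P ?i) z) + of_real (if ?i = 0 then -1 else 0) * of_real a)" for a z
  proof -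
    have "coeff (cspec (shiftc P a) z) ?i = of_real c * coeff (\<Prod>x\<in>#croots P a z. [:-x, 1:]) ?i"
      by (subst cspec_shiftc_factor(1)[OF assms]) simp
    then have "coeff (\<Prod>x\<in>#croots P a z. [:-x, 1:]) ?i = of_real (1 / c) * coeff (cspec (shiftc P a) z) ?i"
      using assms by simp
    then show ?thesis
      using True by (simp add: root_fps_nth cspec_shiftc_factor(2)[OF assms] shiftc_def coeff_pCons split: nat.split)
  qed
  then show ?thesis
    by (simp only:) (intro is_poly3_mult is_poly3_add is_poly3_const is_poly3_poly_z is_poly3_a)
next
  case False
  then show ?thesis
    using is_poly3_const[of 0] by (simp add: root_fps_nth cspec_shiftc_factor(2)[OF assms])
qed

lemma sum_mset_sum_swap:
  fixes c :: "nat \<Rightarrow> 'a::comm_semiring_1"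
  shows "(\<Sum>y\<in>#A. \<Sum>i\<in>I. c i * y ^ i) = (\<Sum>i\<in>I. c i * (\<Sum>y\<in>#A. y ^ i))"
  by (induction A) (simp_all add: sum.distrib distrib_left)

lemma poly_eq_sum_coeff:
  fixes p :: "'a::field poly"
  assumes "degree p \<le> n" shows "poly p x = (\<Sum>i\<le>n. coeff p i * x ^ i)"
  unfolding poly_altdef by (rule sum.mono_neutral_left) (use assms in \<open>auto simp: coeff_eq_0\<close>)

text \<open>The chain is: coefficients, power sums of the roots, power sums of the values of
  \<open>Q\<close> at the roots (by expanding \<open>Q ^ k\<close>), coefficients of the product. Up
  to sign and a power of \<open>c\<close> the result is the resultant of P - a and Q - b with
  respect to y.\<close>

lemma elimination_polynomial:
  assumes "lead_coeff P = [:c:]" "c \<noteq> 0" "degree P \<ge> 1"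
  shows "\<exists>M. \<forall>a b z. complex_of_real (eval3 M a b z) =
           (\<Prod>y\<in>#croots P a z. (of_real b - poly (cspec Q z) y))"
proof -
  define B where "B a b z = image_mset (poly (cspec Q z)) (croots P a z)" for a b z :: real
  have ps: "is_poly3 (\<lambda>a b z. psum (croots P a z) k)" for k
    using is_poly3_root_fps_croots[OF assms] cspec_shiftc_factor(2)[OF assms] by (rule is_poly3_psum)
  have "is_poly3 (\<lambda>a b z. psum (B a b z) k)" for k
  proof -
    have deg: "degree (cspec (Q ^ k) z) \<le> degree (Q ^ k)" for z
      unfolding cspec_def by (rule map_poly_degree_leq)
    have "psum (B a b z) k = (\<Sum>i\<le>degree (Q ^ k). of_real (poly (coeff (Q ^ k) i) z) * psum (croots P a z) i)" for a b z
    proof -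
      have "psum (B a b z) k = (\<Sum>y\<in>#croots P a z. poly (cspec (Q ^ k) z) y)"
        by (simp add: psum_def B_def cspec_power image_mset.compositionality o_def)
      also have "\<dots> = (\<Sum>y\<in>#croots P a z. \<Sum>i\<le>degree (Q ^ k). of_real (poly (coeff (Q ^ k) i) z) * y ^ i)"
        by (subst poly_eq_sum_coeff[OF deg]) simp
      also have "\<dots> = (\<Sum>i\<le>degree (Q ^ k). of_real (poly (coeff (Q ^ k) i) z) * psum (croots P a z) i)"
        unfolding psum_def by (rule sum_mset_sum_swap)
      finally show ?thesis .
    qed
    then show ?thesis
      by (simp only:) (intro is_poly3_sum is_poly3_mult is_poly3_poly_z ps)
  qed
  then have rf: "is_poly3 (\<lambda>a b z. root_fps (B a b z) $ k)" for k
    by (rule is_poly3_root_fps)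
  have eq: "(\<Prod>y\<in>#croots P a z. (of_real b - poly (cspec Q z) y))
      = (\<Sum>k\<le>degree P. root_fps (B a b z) $ k * of_real b ^ (degree P - k))" for a b z
    using prod_diff_eq_sum_root_fps[of "of_real b" "B a b z"]
    by (simp add: B_def cspec_shiftc_factor(2)[OF assms] image_mset.compositionality o_def)
  have "is_poly3 (\<lambda>a b z. \<Prod>y\<in>#croots P a z. (of_real b - poly (cspec Q z) y))"
    unfolding eq by (intro is_poly3_sum is_poly3_mult rf is_poly3_power is_poly3_b)
  then show ?thesis unfolding is_poly3_def by metis
qed

lemma map_poly_cnj_prod: "map_poly cnj (\<Prod>x\<in>#A. [:-x, 1:]) = (\<Prod>x\<in>#A. [:-cnj x, 1:])"
proof (induction A)
  case (add x A)
  have "map_poly cnj (\<Prod>x\<in>#add_mset x A. [:-x, 1:])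
      = map_poly cnj ([:-x, 1:] * (\<Prod>x\<in>#A. [:-x, 1:]))"
    by simp
  also have "\<dots> = map_poly cnj [:-x, 1:] * map_poly cnj (\<Prod>x\<in>#A. [:-x, 1:])"
    by (rule map_poly_mult_hom) simp_all
  finally show ?case using add by (simp add: map_poly_pCons del: mult_pCons_left)
qed simp

section \<open>Evaluation at real points\<close>

definition eval2 :: "real poly poly \<Rightarrow> real \<Rightarrow> real \<Rightarrow> real" where
  "eval2 P x y = poly (poly P [:y:]) x"

lemma eval2_simps [simp]:
  "eval2 (P + Q) x y = eval2 P x y + eval2 Q x y"
  "eval2 (P - Q) x y = eval2 P x y - eval2 Q x y"
  "eval2 (P * Q) x y = eval2 P x y * eval2 Q x y"
  "eval2 (- P) x y = - eval2 P x y"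
  "eval2 0 x y = 0" "eval2 1 x y = 1"
  "eval2 [:q:] x y = poly q x"
  "eval2 (pCons q P) x y = poly q x + y * eval2 P x y"
  by (simp_all add: eval2_def)

lemma continuous_on_eval2 [continuous_intros]:
  assumes "continuous_on S g" "continuous_on S h"
  shows "continuous_on S (\<lambda>w. eval2 P (g w) (h w))"
  by (induction P) (auto intro!: continuous_intros assms)

lemma isCont_eval2 [continuous_intros]:
  assumes "isCont g t" "isCont h t"
  shows "isCont (\<lambda>w. eval2 P (g w) (h w)) t"
  by (induction P) (auto intro!: continuous_intros assms)

lemma isCont_eval3 [continuous_intros]:
  assumes "isCont f t" "isCont g t" "isCont h t"
  shows "isCont (\<lambda>w. eval3 M (f w) (g w) (h w)) t"
proof (induction M)
  case (pCons A M)
  have "(\<lambda>w. eval3 (pCons A M) (f w) (g w) (h w)) = (\<lambda>w. eval2 A (f w) (g w) + h w * eval3 M (f w) (g w) (h w))"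
    by (simp add: eval3_def eval2_def fun_eq_iff)
  then show ?case using pCons assms by (auto intro!: continuous_intros)
qed (simp add: eval3_def)

lemma eval2_eq_sum: "eval2 P x y = (\<Sum>i\<le>degree P. poly (coeff P i) x * y ^ i)"
  unfolding eval2_def poly_altdef[of P] by (simp add: poly_sum poly_power)

lemma prod_mset_nonneg:
  fixes h :: "'a \<Rightarrow> real"
  assumes "\<And>x. x \<in># A \<Longrightarrow> h x \<ge> 0" shows "(\<Prod>x\<in>#A. h x) \<ge> 0"
  using assms by (induction A) auto

section \<open>The sign of the eliminant on vertical lines and strips\<close>

locale monic_map =
  fixes P Q :: "real poly poly" and c :: real and M :: "real poly poly poly"
  assumes lead: "lead_coeff P = [:c:]" and c_nz: "c \<noteq> 0" and deg: "degree P \<ge> 1"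
      and M: "\<And>a b z. complex_of_real (eval3 M a b z) =
           (\<Prod>y\<in>#croots P a z. (of_real b - poly (cspec Q z) y))"
begin

text \<open>The plane is modelled by \<open>complex\<close>, so that planar topology applies
  directly to domain and range.\<close>

definition F :: "complex \<Rightarrow> complex" where
  "F w = Complex (eval2 P (Re w) (Im w)) (eval2 Q (Re w) (Im w))"

lemma F_Complex [simp]: "F (Complex x y) = Complex (eval2 P x y) (eval2 Q x y)"
  by (simp add: F_def)

lemma croots_iff: "y \<in># croots P a z \<longleftrightarrow> poly (cspec (shiftc P a) z) y = 0"
  using cspec_shiftc_factor(3)[OF lead c_nz deg] by (simp add: croots_def)

lemma croots_of_real_iff: "of_real y \<in># croots P a z \<longleftrightarrow> eval2 P z y = a"
  by (simp add: croots_iff poly_cspec_of_real shiftc_def eval2_def)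

text \<open>Conjugation fixes a polynomial with real coefficients; comparing its factorization with
  the conjugated one preserves multiplicities.\<close>

lemma croots_cnj: "image_mset cnj (croots P a z) = croots P a z"
proof -
  let ?A = "croots P a z" and ?p = "cspec (shiftc P a) z"
  have "map_poly cnj ?p = ?p"
    by (rule poly_eqI) (simp add: coeff_map_poly)
  moreover have "map_poly cnj ?p = smult (of_real c) (\<Prod>x\<in>#image_mset cnj ?A. [:-x, 1:])"
    by (subst cspec_shiftc_factor(1)[OF lead c_nz deg])
      (subst map_poly_smult, simp_all add: map_poly_cnj_prod image_mset.compositionality o_def)
  ultimately have "?A = proots (smult (of_real c) (\<Prod>x\<in>#image_mset cnj ?A. [:-x, 1:]))"
    by (simp add: croots_def)
  also have "\<dots> = proots (\<Prod>x\<in>#image_mset cnj ?A. [:-x, 1:])"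
    using c_nz by (intro proots_smult) simp
  finally show ?thesis by (simp only: proots_prod_mset_linear)
qed

definition rroots :: "real \<Rightarrow> real \<Rightarrow> real multiset" where
  "rroots a z = image_mset Re (filter_mset (\<lambda>y. Im y = 0) (croots P a z))"

lemma rroots_iff: "y \<in># rroots a z \<longleftrightarrow> eval2 P z y = a"
proof
  assume "y \<in># rroots a z"
  then obtain u where "u \<in># croots P a z" "Im u = 0" "y = Re u"
    by (auto simp: rroots_def)
  then show "eval2 P z y = a"
    by (metis croots_of_real_iff complex_is_Real_iff of_real_Re)
next
  assume "eval2 P z y = a"
  then have "of_real y \<in># filter_mset (\<lambda>y. Im y = 0) (croots P a z)"
    by (simp add: croots_of_real_iff)
  then show "y \<in># rroots a z"
    unfolding rroots_def by (metis Re_complex_of_real image_eqI set_image_mset)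
qed

text \<open>The non-real roots come in conjugate pairs, and each pair contributes a
  squared modulus.\<close>

lemma eval3_split:
  obtains H where "\<And>b. eval3 M a b z = (\<Prod>y\<in>#rroots a z. (b - eval2 Q z y)) * H b" "\<And>b. H b \<ge> 0"
proof -
  let ?A = "croots P a z"
  define N where "N = filter_mset (\<lambda>y. Im y > 0) ?A"
  define R where "R = filter_mset (\<lambda>y. Im y = 0) ?A"
  have N': "filter_mset (\<lambda>y. Im y < 0) ?A = image_mset cnj N"
  proof -
    have "filter_mset (\<lambda>y. Im y < 0) ?A = filter_mset (\<lambda>y. Im y < 0) (image_mset cnj ?A)"
      by (simp only: croots_cnj)
    also have "\<dots> = image_mset cnj (filter_mset (\<lambda>y. Im (cnj y) < 0) ?A)"
      by (rule filter_mset_image_mset)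
    finally show ?thesis by (simp add: N_def)
  qed
  have A: "?A = R + (N + image_mset cnj N)"
  proof -
    have "?A = filter_mset (\<lambda>y. Im y = 0) ?A + filter_mset (\<lambda>y. \<not> Im y = 0) ?A"
      by (rule multiset_partition)
    moreover have "filter_mset (\<lambda>y. \<not> Im y = 0) ?A = N + filter_mset (\<lambda>y. Im y < 0) ?A"
      unfolding N_def by (rule multiset_eqI) auto
    ultimately show ?thesis unfolding N' R_def by simp
  qed
  define H where "H b = (cmod (\<Prod>y\<in>#N. (of_real b - poly (cspec Q z) y)))\<^sup>2" for b
  have "eval3 M a b z = (\<Prod>y\<in>#rroots a z. (b - eval2 Q z y)) * H b" for b
  proof -
    let ?h = "\<lambda>y. of_real b - poly (cspec Q z) y"
    have R: "(\<Prod>y\<in>#R. ?h y) = of_real (\<Prod>y\<in>#rroots a z. (b - eval2 Q z y))"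
    proof -
      have "(\<Prod>y\<in>#R. ?h y) = (\<Prod>y\<in>#R. of_real (b - eval2 Q z (Re y)))"
      proof (rule arg_cong[where f = prod_mset], rule image_mset_cong)
        fix y assume "y \<in># R"
        then have "y = of_real (Re y)" by (simp add: R_def complex_eq_iff)
        then show "?h y = of_real (b - eval2 Q z (Re y))"
          by (metis eval2_def of_real_diff poly_cspec_of_real)
      qed
      also have "\<dots> = of_real (\<Prod>y\<in>#R. (b - eval2 Q z (Re y)))"
        by (induction R) simp_all
      finally show ?thesis by (simp add: rroots_def R_def image_mset.compositionality o_def)
    qed
    have "(\<Prod>y\<in>#image_mset cnj N. ?h y) = cnj (\<Prod>y\<in>#N. ?h y)"
      by (induction N) (simp_all add: poly_cspec_cnj)
    then have "(\<Prod>y\<in>#N + image_mset cnj N. ?h y) = of_real (H b)"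
      by (simp add: H_def complex_norm_square[symmetric] del: of_real_power)
    then have "complex_of_real (eval3 M a b z) = of_real ((\<Prod>y\<in>#rroots a z. (b - eval2 Q z y)) * H b)"
      by (simp add: M A R)
    then show ?thesis by (simp only: of_real_eq_iff)
  qed
  moreover have "H b \<ge> 0" for b by (simp add: H_def)
  ultimately show thesis by (rule that)
qed

text \<open>By \<open>eval3_split\<close> only the factors of real roots can be negative, and the
  hypothesis gives each of them weakly equal signs at \<open>b1\<close> and
  \<open>b2\<close>.\<close>

lemma eval3_sign_const:
  assumes "\<And>y. eval2 P z y = a \<Longrightarrow> (b1 - eval2 Q z y) * (b2 - eval2 Q z y) \<ge> 0"
  shows "eval3 M a b1 z * eval3 M a b2 z \<ge> 0"
proof -
  obtain H where H: "\<And>b. eval3 M a b z = (\<Prod>y\<in>#rroots a z. (b - eval2 Q z y)) * H b" "\<And>b. H b \<ge> 0"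
    using eval3_split by blast
  have "(\<Prod>y\<in>#rroots a z. (b1 - eval2 Q z y) * (b2 - eval2 Q z y)) \<ge> 0"
    by (rule prod_mset_nonneg) (use assms in \<open>simp add: rroots_iff\<close>)
  then have "0 \<le> (\<Prod>y\<in>#rroots a z. (b1 - eval2 Q z y) * (b2 - eval2 Q z y)) * (H b1 * H b2)"
    by (intro mult_nonneg_nonneg H)
  also have "\<dots> = eval3 M a b1 z * eval3 M a b2 z"
    by (simp add: H(1) prod_mset.distrib mult_ac)
  finally show ?thesis .
qed

text \<open>A multiple root would also be a zero of the derivative in y, which the shift by
  \<open>a\<close> does not affect.\<close>

lemma count_croots_simple:
  assumes "eval2 P z y = a" "eval2 (pderiv P) z y \<noteq> 0"
  shows "count (croots P a z) (of_real y) = 1"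
proof (rule ccontr)
  let ?y = "complex_of_real y" and ?A = "croots P a z"
  assume "count ?A ?y \<noteq> 1"
  moreover have "?y \<in># ?A" using assms by (simp add: croots_of_real_iff)
  then have "count ?A ?y \<noteq> 0" by simp
  ultimately have "count ?A ?y \<ge> 2" by linarith
  then have "replicate_mset 2 ?y \<subseteq># ?A"
    by (simp add: count_le_replicate_mset_subset_eq)
  then obtain B where B: "?A = replicate_mset 2 ?y + B"
    by (auto simp: mset_subset_eq_exists_conv)
  have "cspec (shiftc P a) z = smult (of_real c) ([:-?y, 1:]\<^sup>2 * (\<Prod>x\<in>#B. [:-x, 1:]))"
    by (subst cspec_shiftc_factor(1)[OF lead c_nz deg]) (simp only: B power2_eq_square mult.assoc numeral_2_eq_2 replicate_mset_Suc replicate_mset_0 add_mset_add_single[symmetric] image_mset_add_mset union_mset_add_mset_left add_0 prod_mset.add_mset power_Suc power_0 mult_1_right)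
  then have "poly (pderiv (cspec (shiftc P a) z)) ?y = 0"
    by (simp add: pderiv_mult pderiv_smult pderiv_power power2_eq_square pderiv_pCons del: mult_pCons_left mult_pCons_right)
  moreover have "pderiv (cspec (shiftc P a) z) = cspec (pderiv P) z"
    by (rule poly_eqI) (simp add: coeff_pderiv shiftc_def)
  ultimately show False
    using assms by (simp add: poly_cspec_of_real eval2_def)
qed

lemma count_rroots_simple:
  assumes "eval2 P z y = a" "eval2 (pderiv P) z y \<noteq> 0"
  shows "count (rroots a z) y = 1"
proof -
  let ?A = "filter_mset (\<lambda>y. Im y = 0) (croots P a z)"
  have "count (image_mset Re ?A) y = sum (count ?A) (Re -` {y} \<inter> set_mset ?A)"
    by (rule count_image_mset)
  also have "Re -` {y} \<inter> set_mset ?A = {of_real y}"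
    using assms by (auto simp: complex_eq_iff croots_of_real_iff)
  finally show ?thesis
    using count_croots_simple[OF assms] by (simp add: rroots_def)
qed

text \<open>Exactly one factor changes sign. Simplicity of \<open>y0\<close> matters here: a root of
  even multiplicity would leave the sign of the product unchanged.\<close>

lemma eval3_sign_flip:
  assumes y0: "eval2 P z y0 = a" "eval2 (pderiv P) z y0 \<noteq> 0"
      and flip: "(b1 - eval2 Q z y0) * (b2 - eval2 Q z y0) \<le> 0"
      and other: "\<And>y. eval2 P z y = a \<Longrightarrow> y \<noteq> y0 \<Longrightarrow> (b1 - eval2 Q z y) * (b2 - eval2 Q z y) \<ge> 0"
  shows "eval3 M a b1 z * eval3 M a b2 z \<le> 0"
proof -
  obtain H where H: "\<And>b. eval3 M a b z = (\<Prod>y\<in>#rroots a z. (b - eval2 Q z y)) * H b" "\<And>b. H b \<ge> 0"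
    using eval3_split by blast
  have y0_in: "y0 \<in># rroots a z" using y0 by (simp add: rroots_iff)
  define B where "B = rroots a z - {#y0#}"
  have B: "rroots a z = add_mset y0 B" using y0_in by (simp add: B_def)
  have "count B y0 = 0" using count_rroots_simple[OF y0] by (simp add: B_def)
  then have y0B: "y0 \<notin># B" by (simp add: count_eq_zero_iff)
  let ?h = "\<lambda>y. (b1 - eval2 Q z y) * (b2 - eval2 Q z y)"
  have "(\<Prod>y\<in>#B. ?h y) \<ge> 0"
  proof (rule prod_mset_nonneg)
    fix y assume "y \<in># B"
    then have "y \<in># rroots a z" "y \<noteq> y0" using y0B by (auto simp: B)
    then show "?h y \<ge> 0" using other by (simp add: rroots_iff)
  qed
  then have "?h y0 * ((\<Prod>y\<in>#B. ?h y) * (H b1 * H b2)) \<le> 0"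
    by (intro mult_nonpos_nonneg flip mult_nonneg_nonneg H)
  also have "?h y0 * ((\<Prod>y\<in>#B. ?h y) * (H b1 * H b2)) = eval3 M a b1 z * eval3 M a b2 z"
    by (simp add: H(1) B prod_mset.distrib mult_ac)
  finally show ?thesis .
qed

text \<open>For fixed \<open>a\<close> and \<open>z\<close> the eliminant is a nonempty product of
  linear factors in \<open>b\<close>. This lets \<open>b\<close> be moved slightly so that weak sign
  statements become strict.\<close>

lemma finite_eval3_zeros: "finite {b. eval3 M a b z = 0}"
proof -
  have "{b. eval3 M a b z = 0} \<subseteq> Re ` poly (cspec Q z) ` set_mset (croots P a z)"
  proof
    fix b assume "b \<in> {b. eval3 M a b z = 0}"
    then have "(\<Prod>y\<in>#croots P a z. (of_real b - poly (cspec Q z) y)) = 0"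
      using M[of a b z] by simp
    then obtain y where "y \<in># croots P a z" "of_real b = poly (cspec Q z) y"
      by (auto simp: prod_mset_zero_iff)
    then show "b \<in> Re ` poly (cspec Q z) ` set_mset (croots P a z)"
      by (metis Re_complex_of_real image_eqI)
  qed
  then show ?thesis using finite_subset by blast
qed

lemma continuous_on_F: "continuous_on S F"
  unfolding F_def Complex_eq by (intro continuous_intros)

text \<open>For |y| > 1 the lower terms are at most K |y|^e, where e is \<open>degree P\<close>
  minus 1, while the leading term has modulus |c| |y|^(e+1); division by |y|^e bounds |y|.\<close>

lemma Im_bounded: "\<exists>B. \<forall>x y. \<bar>x\<bar> \<le> r \<longrightarrow> \<bar>eval2 P x y\<bar> \<le> r \<longrightarrow> \<bar>y\<bar> \<le> B"
proof -
  let ?d = "degree P"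
  have "compact ((\<lambda>x. \<Sum>i<?d. \<bar>poly (coeff P i) x\<bar>) ` {-r..r})"
    by (intro compact_continuous_image continuous_intros) auto
  then obtain K where K: "\<And>x. x \<in> {-r..r} \<Longrightarrow> \<bar>\<Sum>i<?d. \<bar>poly (coeff P i) x\<bar>\<bar> \<le> K"
    unfolding bounded_real using compact_imp_bounded by (force simp: bounded_real)
  have "\<bar>y\<bar> \<le> max 1 ((r + K) / \<bar>c\<bar>)" if x: "\<bar>x\<bar> \<le> r" and a: "\<bar>eval2 P x y\<bar> \<le> r" for x y
  proof (cases "\<bar>y\<bar> \<le> 1")
    case False
    have r: "r \<ge> 0" using x by linarith
    obtain e where e: "?d = Suc e" using deg by (cases ?d) auto
    have "eval2 P x y = (\<Sum>i<?d. poly (coeff P i) x * y ^ i) + c * y ^ ?d"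
      using lead by (simp add: eval2_eq_sum lessThan_Suc_atMost[symmetric])
    then have "\<bar>c\<bar> * \<bar>y\<bar> ^ ?d = \<bar>eval2 P x y - (\<Sum>i<?d. poly (coeff P i) x * y ^ i)\<bar>"
      by (simp add: abs_mult power_abs)
    also have "\<dots> \<le> \<bar>eval2 P x y\<bar> + \<bar>\<Sum>i<?d. poly (coeff P i) x * y ^ i\<bar>"
      by (rule abs_triangle_ineq4)
    also have "\<bar>\<Sum>i<?d. poly (coeff P i) x * y ^ i\<bar> \<le> (\<Sum>i<?d. \<bar>poly (coeff P i) x * y ^ i\<bar>)"
      by (rule sum_abs)
    also have "(\<Sum>i<?d. \<bar>poly (coeff P i) x * y ^ i\<bar>) \<le> (\<Sum>i<?d. \<bar>poly (coeff P i) x\<bar> * \<bar>y\<bar> ^ e)"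
    proof (rule sum_mono)
      fix i assume "i \<in> {..<?d}"
      then have "\<bar>y\<bar> ^ i \<le> \<bar>y\<bar> ^ e" using False e by (intro power_increasing) auto
      then show "\<bar>poly (coeff P i) x * y ^ i\<bar> \<le> \<bar>poly (coeff P i) x\<bar> * \<bar>y\<bar> ^ e"
        by (simp add: abs_mult power_abs mult_left_mono)
    qed
    also have "\<dots> = (\<Sum>i<?d. \<bar>poly (coeff P i) x\<bar>) * \<bar>y\<bar> ^ e"
      by (simp add: sum_distrib_right)
    also have "\<dots> \<le> K * \<bar>y\<bar> ^ e"
      using K[of x] x by (intro mult_right_mono) (auto simp: abs_le_iff)
    also have "\<bar>eval2 P x y\<bar> \<le> r * \<bar>y\<bar> ^ e"
      using order_trans[OF a] mult_left_mono[of 1 "\<bar>y\<bar> ^ e" r] one_le_power[of "\<bar>y\<bar>" e] False r by simp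
    finally have "(\<bar>c\<bar> * \<bar>y\<bar>) * \<bar>y\<bar> ^ e \<le> (r + K) * \<bar>y\<bar> ^ e"
      by (simp add: e algebra_simps)
    then have "\<bar>c\<bar> * \<bar>y\<bar> \<le> r + K"
      by (rule mult_right_le_imp_le) (use False in simp)
    then have "\<bar>y\<bar> \<le> (r + K) / \<bar>c\<bar>" using c_nz by (simp add: field_simps)
    then show ?thesis by simp
  qed simp
  then show ?thesis by blast
qed

definition strip :: "real \<Rightarrow> real \<Rightarrow> complex set" where
  "strip z1 z2 = {w. z1 \<le> Re w \<and> Re w \<le> z2}"

text \<open>On a vertical strip F is proper: the abscissa is bounded by the strip, and along a
  convergent sequence of images \<open>Im_bounded\<close> bounds the ordinate, so a subsequence of
  preimages converges.\<close>

lemma closed_image_strip: "closed (F ` strip z1 z2)"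
  unfolding closed_sequential_limits
proof (intro allI impI, elim conjE)
  fix q l assume q: "\<forall>n. q n \<in> F ` strip z1 z2" and lim: "q \<longlonglongrightarrow> l"
  from q have "\<forall>n. \<exists>w. w \<in> strip z1 z2 \<and> q n = F w" by blast
  then obtain w where w: "\<And>n. w n \<in> strip z1 z2" "\<And>n. q n = F (w n)"
    by (auto dest!: choice)
  obtain K where K: "\<And>n. cmod (q n) \<le> K"
    using convergent_imp_bounded[OF lim] by (auto simp: bounded_iff)
  define r where "r = max K (max \<bar>z1\<bar> \<bar>z2\<bar>)"
  obtain B where B: "\<And>x y. \<bar>x\<bar> \<le> r \<Longrightarrow> \<bar>eval2 P x y\<bar> \<le> r \<Longrightarrow> \<bar>y\<bar> \<le> B"
    using Im_bounded by blast
  have Re: "\<bar>Re (w n)\<bar> \<le> r" for n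
    using w(1)[of n] by (auto simp: strip_def r_def)
  have "\<bar>eval2 P (Re (w n)) (Im (w n))\<bar> \<le> r" for n
    using abs_Re_le_cmod[of "q n"] K[of n] by (simp add: w(2) F_def r_def)
  with Re B have Im: "\<bar>Im (w n)\<bar> \<le> B" for n by blast
  have "cmod (w n) \<le> r + B" for n
    using cmod_le[of "w n"] Re[of n] Im[of n] by linarith
  then have "bounded (range w)" by (auto simp: bounded_iff)
  then obtain v s where s: "strict_mono s" "(w \<circ> s) \<longlonglongrightarrow> v"
    using bounded_imp_convergent_subsequence by blast
  have "closed (strip z1 z2)"
    unfolding strip_def by (intro closed_Collect_conj closed_Collect_le continuous_intros)
  then have v: "v \<in> strip z1 z2"
    by (rule closed_sequentially[where f = "w \<circ> s"]) (use w s in auto)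
  have "(\<lambda>n. F ((w \<circ> s) n)) \<longlonglongrightarrow> F v"
    using continuous_on_F[of UNIV] s(2) by (rule continuous_on_tendsto_compose) auto
  moreover have "(\<lambda>n. F ((w \<circ> s) n)) \<longlonglongrightarrow> l"
    using LIMSEQ_subseq_LIMSEQ[OF lim s(1)] by (simp add: w(2) o_def)
  ultimately show "l \<in> F ` strip z1 z2" using v LIMSEQ_unique by blast
qed

text \<open>Since the image of the strip is closed, no \<open>(a, b')\<close> with \<open>b'\<close> near \<open>b\<close> has a solution there, so
  for each \<open>z\<close> the sign of \<open>M\<close> does not depend on \<open>b'\<close>; connectedness of the interval does the rest.\<close>

lemma eval3_sign_strip:
  assumes q: "Complex a b \<notin> F ` strip z1 z2" and z: "z1 \<le> z2"
  shows "eval3 M a b z1 * eval3 M a b z2 \<ge> 0"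
proof -
  have "open (- (F ` strip z1 z2))" using closed_image_strip by blast
  then obtain e where e: "e > 0" "\<And>u. dist (Complex a b) u < e \<Longrightarrow> u \<notin> F ` strip z1 z2"
    using q unfolding open_dist by (metis ComplI ComplD dist_commute)
  \<comment> \<open>A whole interval around \<open>b\<close> is kept because the eliminant may
    vanish at \<open>b\<close> for some \<open>z\<close>. The radius e/2 keeps its end points within
    distance e.\<close>
  define W where "W = {b - e/2 .. b + e/2}"
  have W: "Complex a b' \<notin> F ` strip z1 z2" if "b' \<in> W" for b'
  proof (rule e(2))
    have "dist (Complex a b) (Complex a b') = \<bar>b - b'\<bar>"
      by (simp add: dist_norm complex_norm complex_diff)
    then show "dist (Complex a b) (Complex a b') < e" using that e by (auto simp: W_def)
  qed
  have const: "eval3 M a b1 z * eval3 M a b2 z \<ge> 0" if "b1 \<in> W" "b2 \<in> W" "z \<in> {z1..z2}" for b1 b2 z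
  proof (rule eval3_sign_const)
    fix y assume y: "eval2 P z y = a"
    have "Complex a (eval2 Q z y) \<in> F ` strip z1 z2"
      using that(3) y by (intro image_eqI[of _ _ "Complex z y"]) (auto simp: strip_def)
    then have "eval2 Q z y \<notin> W" using W by blast
    with that show "(b1 - eval2 Q z y) * (b2 - eval2 Q z y) \<ge> 0"
      by (auto simp: W_def zero_le_mult_iff)
  qed
  define Pos where "Pos = {z\<in>{z1..z2}. \<forall>b'\<in>W. eval3 M a b' z \<ge> 0}"
  define Neg where "Neg = {z\<in>{z1..z2}. \<forall>b'\<in>W. eval3 M a b' z \<le> 0}"
  have "closed Pos"
  proof -
    have "Pos = {z1..z2} \<inter> (\<Inter>b'\<in>W. {z. 0 \<le> eval3 M a b' z})" by (auto simp: Pos_def)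
    then show ?thesis
      by (auto intro!: closed_Int closed_INT closed_Collect_le continuous_at_imp_continuous_on continuous_intros)
  qed
  moreover have "closed Neg"
  proof -
    have "Neg = {z1..z2} \<inter> (\<Inter>b'\<in>W. {z. eval3 M a b' z \<le> 0})" by (auto simp: Neg_def)
    then show ?thesis
      by (auto intro!: closed_Int closed_INT closed_Collect_le continuous_at_imp_continuous_on continuous_intros)
  qed
  \<comment> \<open>In the intersection the eliminant would vanish for every b' in the infinite set
    \<open>W\<close>, against the finiteness of its zeros.\<close>
  moreover have "Pos \<inter> Neg \<inter> {z1..z2} = {}"
  proof -
    have "W \<subseteq> {b'. eval3 M a b' z = 0}" if "z \<in> Pos" "z \<in> Neg" for z
      using that by (force simp: Pos_def Neg_def)
    moreover have "infinite W" using e by (simp add: W_def)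
    ultimately show ?thesis using finite_eval3_zeros finite_subset by blast
  qed
  moreover have cover: "{z1..z2} \<subseteq> Pos \<union> Neg"
  proof
    fix z assume z: "z \<in> {z1..z2}"
    show "z \<in> Pos \<union> Neg"
    proof (rule ccontr)
      assume "z \<notin> Pos \<union> Neg"
      then obtain b1 b2 where "b1 \<in> W" "b2 \<in> W" "eval3 M a b1 z < 0" "eval3 M a b2 z > 0"
        using z unfolding Pos_def Neg_def by force
      with const[OF _ _ z, of b1 b2] show False
        by (simp add: zero_le_mult_iff)
    qed
  qed
  ultimately have "Pos \<inter> {z1..z2} = {} \<or> Neg \<inter> {z1..z2} = {}"
    using connected_closedD[of "{z1..z2}" Pos Neg] connected_Icc by blast
  moreover have "z1 \<in> {z1..z2}" "z2 \<in> {z1..z2}" using z by auto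
  ultimately have "(z1 \<in> Pos \<and> z2 \<in> Pos) \<or> (z1 \<in> Neg \<and> z2 \<in> Neg)"
    using cover by blast
  moreover have "b \<in> W" using e by (simp add: W_def)
  ultimately show ?thesis
    by (auto simp: Pos_def Neg_def zero_le_mult_iff)
qed

end

section \<open>Parity of the degree of the eliminant\<close>

definition spec2 :: "real poly poly \<Rightarrow> real \<Rightarrow> real poly" where
  "spec2 A x = map_poly (\<lambda>q. poly q x) A"

lemma coeff_spec2 [simp]: "coeff (spec2 A x) n = poly (coeff A n) x"
  by (simp add: spec2_def coeff_map_poly)

lemma poly_spec2: "poly (spec2 A x) y = eval2 A x y"
  by (induction A) (simp_all add: spec2_def map_poly_pCons)

definition spec3 :: "real poly poly poly \<Rightarrow> real \<Rightarrow> real \<Rightarrow> real poly" where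
  "spec3 M a b = map_poly (\<lambda>A. eval2 A a b) M"

lemma coeff_spec3 [simp]: "coeff (spec3 M a b) n = eval2 (coeff M n) a b"
  by (simp add: spec3_def coeff_map_poly)

lemma eval3_pCons: "eval3 (pCons A M) a b z = eval2 A a b + z * eval3 M a b z"
  by (simp add: eval3_def eval2_def)

lemma poly_spec3: "poly (spec3 M a b) z = eval3 M a b z"
proof (induction M)
  case (pCons A M)
  then show ?case by (simp add: eval3_pCons spec3_def map_poly_pCons)
qed (simp add: spec3_def eval3_def)

text \<open>First an abscissa is chosen off the zeros of the leading coefficient in y; the slice
  there is a nonzero univariate polynomial, and again only finitely many values are
  excluded.\<close>

lemma eval2_nonzero_dense:
  assumes "A \<noteq> 0" "open S" "S \<noteq> {}"
  obtains w where "w \<in> S" "eval2 A (Re w) (Im w) \<noteq> 0"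
proof -
  obtain u where u: "u \<in> S" using assms by blast
  then obtain e where e: "e > 0" "ball u e \<subseteq> S" using assms open_contains_ball by blast
  have near: "\<exists>t. \<bar>t - t0\<bar> < e/2 \<and> poly p t \<noteq> 0" if "p \<noteq> 0" for p :: "real poly" and t0
  proof -
    have "finite {t. poly p t = 0}" using that by (rule poly_roots_finite)
    moreover have "infinite {t0<..<t0 + e/2}" using e by simp
    ultimately have "\<not> {t0<..<t0 + e/2} \<subseteq> {t. poly p t = 0}" using finite_subset by blast
    then obtain t where "t0 < t" "t < t0 + e/2" "poly p t \<noteq> 0"
      unfolding subset_iff by auto
    then show ?thesis by (intro exI[of _ t]) auto
  qed
  obtain x where x: "\<bar>x - Re u\<bar> < e/2" "poly (lead_coeff A) x \<noteq> 0"
    using near[of "lead_coeff A"] assms(1) by auto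
  have "spec2 A x \<noteq> 0"
    using x(2) by (metis coeff_0 coeff_spec2)
  then obtain y where y: "\<bar>y - Im u\<bar> < e/2" "eval2 A x y \<noteq> 0"
    using near[of "spec2 A x"] by (auto simp: poly_spec2)
  have "cmod (Complex x y - u) < e"
    using cmod_le[of "Complex x y - u"] x(1) y(1) by simp
  then have "Complex x y \<in> S" using e(2) by (auto simp: dist_norm norm_minus_commute)
  with y(2) show thesis by (intro that) auto
qed

text \<open>For large z the values at z and -z have the signs of the leading coefficient and of
  (-1)^degree times it. The value at -z is handled by composing with the reflection
  \<open>[:0, -1:]\<close>.\<close>

lemma poly_signs_at_infinity:
  fixes m :: "real poly"
  assumes "m \<noteq> 0"
  obtains r where "\<And>z. z \<ge> r \<Longrightarrow> (-1) ^ degree m * (poly m z * poly m (-z)) > 0"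
proof -
  have pos: "\<exists>r. \<forall>z\<ge>r. lead_coeff p * poly p z > 0" if "p \<noteq> 0" for p :: "real poly"
  proof (cases "lead_coeff p > 0")
    case True
    then obtain n where "\<forall>x\<ge>n. poly p x \<ge> lead_coeff p" using poly_pinfty_gt_lc by blast
    with True show ?thesis by (meson mult_pos_pos order_less_le_trans)
  next
    case False
    with that have neg: "lead_coeff (-p) > 0" by (metis degree_minus coeff_minus leading_coeff_0_iff linorder_neqE_linordered_idom neg_0_less_iff_less)
    then obtain n where n: "\<forall>x\<ge>n. poly (-p) x \<ge> lead_coeff (-p)" using poly_pinfty_gt_lc by blast
    have "lead_coeff p * poly p z > 0" if "z \<ge> n" for z
    proof -
      have "poly (-p) z > 0" using n neg that by (meson order_less_le_trans)
      then show ?thesis using neg by (simp add: mult_neg_neg)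
    qed
    then show ?thesis by blast
  qed
  define m' where "m' = m \<circ>\<^sub>p [:0, -1:]"
  have deg: "degree m' = degree m" by (simp add: m'_def degree_pcompose)
  have lc: "lead_coeff m' = lead_coeff m * (-1) ^ degree m"
    unfolding m'_def by (subst lead_coeff_comp) simp_all
  have "m' \<noteq> 0" using lc assms by auto
  obtain r1 where r1: "\<And>z. z \<ge> r1 \<Longrightarrow> lead_coeff m * poly m z > 0" using pos[OF assms] by blast
  obtain r2 where r2: "\<And>z. z \<ge> r2 \<Longrightarrow> lead_coeff m' * poly m' z > 0" using pos[OF \<open>m' \<noteq> 0\<close>] by blast
  have "(-1) ^ degree m * (poly m z * poly m (-z)) > 0" if "z \<ge> max r1 r2" for z
  proof -
    have "0 < (lead_coeff m * poly m z) * (lead_coeff m' * poly m' z)"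
      by (rule mult_pos_pos[OF r1 r2]) (use that in auto)
    also have "\<dots> = (lead_coeff m)\<^sup>2 * ((-1) ^ degree m * (poly m z * poly m (-z)))"
      unfolding lc by (simp add: m'_def poly_pcompose power2_eq_square mult_ac)
    finally show ?thesis by (simp add: zero_less_mult_iff)
  qed
  then show thesis using that by blast
qed

text \<open>Turns the sign behaviour outside the image of F into parity; the next lemma does so on
  the image, where the sign changes across one abscissa.\<close>

lemma even_degree_of_signs:
  fixes m :: "real poly"
  assumes "m \<noteq> 0" "\<And>z1 z2. z1 \<le> z2 \<Longrightarrow> poly m z1 * poly m z2 \<ge> 0"
  shows "even (degree m)"
proof (rule ccontr)
  assume odd: "odd (degree m)"
  obtain r where r: "\<And>z. z \<ge> r \<Longrightarrow> (-1) ^ degree m * (poly m z * poly m (-z)) > 0"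
    using poly_signs_at_infinity[OF assms(1)] by blast
  have "poly m (max r 0) * poly m (- max r 0) < 0"
    using r[of "max r 0"] odd by simp
  moreover have "poly m (- max r 0) * poly m (max r 0) \<ge> 0"
    by (rule assms) auto
  ultimately show False by (simp add: mult.commute)
qed

lemma odd_degree_of_signs:
  fixes m :: "real poly"
  assumes "m \<noteq> 0" "\<And>z1 z2. z1 < x \<Longrightarrow> x < z2 \<Longrightarrow> poly m z1 * poly m z2 \<le> 0"
  shows "odd (degree m)"
proof
  assume even: "even (degree m)"
  obtain r where r: "\<And>z. z \<ge> r \<Longrightarrow> (-1) ^ degree m * (poly m z * poly m (-z)) > 0"
    using poly_signs_at_infinity[OF assms(1)] by blast
  \<comment> \<open>The term |x| + 1 places x strictly between -?z and ?z.\<close>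
  let ?z = "max r (\<bar>x\<bar> + 1)"
  have "poly m ?z * poly m (- ?z) > 0"
    using r[of ?z] even by simp
  moreover have "poly m (- ?z) * poly m ?z \<le> 0"
    by (rule assms) auto
  ultimately show False by (simp add: mult.commute)
qed

section \<open>Injective maps with invertible derivative\<close>

locale inj_map = monic_map +
  assumes inj: "inj F"
      and der: "\<And>w. \<exists>L. (F has_derivative L) (at w) \<and> inj L"
begin

definition G :: "complex \<Rightarrow> complex" where "G = inv F"

lemma G_F [simp]: "G (F w) = w"
  using inj by (simp add: G_def)

lemma open_image_F: "open S \<Longrightarrow> open (F ` S)"
  by (rule invariance_of_domain[OF continuous_on_F]) (use inj inj_on_subset in auto)

lemma continuous_on_G: "continuous_on (range F) G"
  by (rule continuous_on_inverse_open) (use continuous_on_F in auto)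

text \<open>The imaginary unit is the direction of y. Differentiating the first component along the
  vertical line through \<open>w\<close> in two ways identifies the entry of \<open>L\<close> with
  the formal derivative.\<close>

lemma has_derivative_F_Im:
  assumes "(F has_derivative L) (at w)"
  shows "Re (L \<i>) = eval2 (pderiv P) (Re w) (Im w)"
proof -
  have "((\<lambda>t. w + t *\<^sub>R \<i>) has_derivative (\<lambda>t. t *\<^sub>R \<i>)) (at 0)"
    by (auto intro!: derivative_eq_intros)
  moreover have "(F has_derivative L) (at (w + 0 *\<^sub>R \<i>))"
    using assms by simp
  ultimately have "((\<lambda>t. F (w + t *\<^sub>R \<i>)) has_derivative (\<lambda>t. L (t *\<^sub>R \<i>))) (at 0)"
    by (rule has_derivative_compose)
  then have "((\<lambda>t. Re (F (w + t *\<^sub>R \<i>))) has_derivative (\<lambda>t. Re (L (t *\<^sub>R \<i>)))) (at 0)"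
    by (rule has_derivative_Re)
  moreover have "(\<lambda>t. Re (L (t *\<^sub>R \<i>))) = (*) (Re (L \<i>))"
    using linear_scale[OF has_derivative_linear[OF assms]] by (auto simp: fun_eq_iff)
  ultimately have "((\<lambda>t. Re (F (w + t *\<^sub>R \<i>))) has_real_derivative Re (L \<i>)) (at 0)"
    by (simp add: has_field_derivative_def)
  moreover have "((\<lambda>t. Re (F (w + t *\<^sub>R \<i>))) has_real_derivative eval2 (pderiv P) (Re w) (Im w)) (at 0)"
  proof -
    have "poly (pderiv (spec2 P (Re w))) (Im w) = eval2 (pderiv P) (Re w) (Im w)"
    proof -
      have "pderiv (spec2 P (Re w)) = spec2 (pderiv P) (Re w)"
        by (rule poly_eqI) (simp add: coeff_pderiv)
      then show ?thesis by (simp add: poly_spec2)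
    qed
    moreover have "((\<lambda>t. poly (spec2 P (Re w)) (Im w + t)) has_real_derivative
        poly (pderiv (spec2 P (Re w))) (Im w)) (at 0)"
      by (auto intro!: derivative_eq_intros)
    ultimately show ?thesis by (simp add: F_def poly_spec2)
  qed
  ultimately show ?thesis by (rule DERIV_unique)
qed

text \<open>As \<open>b\<close> crosses \<open>b0\<close>, the abscissa \<open>X\<close> of the solution crosses \<open>Re w0\<close> with nonzero speed, because
  \<open>f\<^sub>y \<noteq> 0\<close>.  On either side of \<open>b0\<close> one of the two strips cut off by \<open>Re w0\<close> therefore contains no
  solution, while on the line \<open>z = Re w0\<close> the sign of \<open>M\<close> flips at \<open>b0\<close>.\<close>

lemma eval3_sign_flip_generic:
  assumes w0: "F w0 = Complex a b0" and fy: "eval2 (pderiv P) (Re w0) (Im w0) \<noteq> 0"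
      and z: "z1 < Re w0" "Re w0 < z2"
  shows "eval3 M a b0 z1 * eval3 M a b0 z2 \<le> 0"
proof (rule ccontr)
  assume "\<not> ?thesis"
  then have sg: "eval3 M a b0 z1 * eval3 M a b0 z2 > 0" by simp
  let ?q = "Complex a b0"
  define x0 where "x0 = Re w0"
  define y0 where "y0 = Im w0"
  have w0_eq: "w0 = Complex x0 y0" by (simp add: x0_def y0_def)
  have fx0: "eval2 P x0 y0 = a" and gx0: "eval2 Q x0 y0 = b0"
    using w0 by (simp_all add: w0_eq)
  obtain L where L: "(F has_derivative L) (at w0)" "inj L" using der by blast
  interpret L: bounded_linear L using L(1) by (rule has_derivative_bounded_linear)
  obtain L' where L': "linear L'" "L' \<circ> L = id"
    using linear_injective_left_inverse[OF L.linear_axioms L(2)] by blast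
  have q_in: "?q \<in> range F" by (metis w0 rangeI)
  have G_der: "(G has_derivative L') (at ?q)"
  proof (rule has_derivative_inverse_basic[where f = F and f' = L and T = "range F"])
    show "(F has_derivative L) (at (G ?q))" using L(1) w0 by (metis G_F)
    show "bounded_linear L'" using L'(1) linear_conv_bounded_linear by blast
    show "continuous (at ?q) G"
      using continuous_on_G q_in unfolding continuous_on_eq_continuous_at[OF open_image_F[OF open_UNIV]]
      by blast
    show "open (range F)" using open_image_F by blast
  qed (use L'(2) q_in in auto)
  \<comment> \<open>The speed of the abscissa of the preimage as \<open>b\<close> moves,
    \<open>L'\<close> being the derivative of the inverse. If it were 0, then \<open>L\<close> would
    map a vertical vector to the vertical direction, and the real part would give s f_y = 0.\<close>
  define D where "D = Re (L' \<i>)"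
  have "D \<noteq> 0"
  proof
    assume "D = 0"
    define s where "s = Im (L' \<i>)"
    have "L' \<i> = s *\<^sub>R \<i>" using \<open>D = 0\<close> by (simp add: complex_eq_iff D_def s_def)
    moreover have "surj L" using L(2) L.linear_axioms by (simp add: linear_injective_imp_surjective)
    then have "L (L' \<i>) = \<i>" using L'(2) by (metis comp_apply id_apply surj_def)
    ultimately have "s *\<^sub>R L \<i> = \<i>" by (simp add: L.scaleR)
    then have "s * eval2 (pderiv P) (Re w0) (Im w0) = 0"
      using has_derivative_F_Im[OF L(1)] by (metis scaleR_complex.sel(1) imaginary_unit.sel(1))
    then have "s = 0" using fy by simp
    with \<open>s *\<^sub>R L \<i> = \<i>\<close> show False by simp
  qed
  \<comment> \<open>Orients the path in \<open>b\<close> so that the abscissa \<open>X\<close>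
    increases at 0 whatever the sign of \<open>D\<close>.\<close>
  define s where "s = sgn D"
  have s: "s = 1 \<or> s = -1" using \<open>D \<noteq> 0\<close> by (auto simp: s_def sgn_if)
  define B where "B t = b0 + s * t" for t
  define X where "X t = Re (G (Complex a (B t)))" for t
  have X_der: "(X has_real_derivative s * D) (at 0)"
  proof -
    have "((\<lambda>t. ?q + (s * t) *\<^sub>R \<i>) has_derivative (\<lambda>t. (s * t) *\<^sub>R \<i>)) (at 0)"
      by (auto intro!: derivative_eq_intros)
    moreover have "(G has_derivative L') (at (?q + (s * 0) *\<^sub>R \<i>))"
      using G_der by simp
    ultimately have "((\<lambda>t. G (?q + (s * t) *\<^sub>R \<i>)) has_derivative (\<lambda>t. L' ((s * t) *\<^sub>R \<i>))) (at 0)"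
      by (rule has_derivative_compose)
    then have "((\<lambda>t. Re (G (?q + (s * t) *\<^sub>R \<i>))) has_derivative (\<lambda>t. Re (L' ((s * t) *\<^sub>R \<i>)))) (at 0)"
      by (rule has_derivative_Re)
    moreover have "(\<lambda>t. Re (L' ((s * t) *\<^sub>R \<i>))) = (*) (s * D)"
      by (auto simp: fun_eq_iff linear_scale[OF L'(1)] D_def)
    moreover have "(\<lambda>t. Re (G (?q + (s * t) *\<^sub>R \<i>))) = X"
      by (simp add: fun_eq_iff X_def B_def complex_eq_iff Complex_eq algebra_simps scaleR_conv_of_real)
    ultimately show ?thesis by (simp add: has_field_derivative_def)
  qed
  have sD: "s * D > 0" using \<open>D \<noteq> 0\<close> by (simp add: s_def sgn_if)
  have X0: "X 0 = x0" using w0 by (metis B_def G_F X_def add.right_neutral mult_zero_right x0_def)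
  have "\<exists>d>0. \<forall>t>0. t < d \<longrightarrow> x0 < X t" "\<exists>d>0. \<forall>t>0. t < d \<longrightarrow> X (- t) < x0"
    using DERIV_pos_inc_right[OF X_der sD] DERIV_pos_inc_left[OF X_der sD] by (simp_all only: X0 add_0 diff_0)
  then obtain d1 d2 where
      d1: "d1 > 0" "\<And>t. 0 < t \<Longrightarrow> t < d1 \<Longrightarrow> x0 < X t" and
      d2: "d2 > 0" "\<And>t. 0 < t \<Longrightarrow> t < d2 \<Longrightarrow> X (- t) < x0"
    by metis
  have cont_B: "isCont B t" for t unfolding B_def by (intro continuous_intros)
  have B0: "B 0 = b0" by (simp add: B_def)
  have ev: "eventually (\<lambda>t. h t > 0) (nhds 0)" if "isCont h 0" "h 0 > 0" for h :: "real \<Rightarrow> real"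
    using that order_tendstoD(1) unfolding isCont_def tendsto_at_iff_tendsto_nhds by blast
  \<comment> \<open>The assumed strict inequality makes the eliminant nonzero at \<open>b0\<close>
    for both \<open>z1\<close> and \<open>z2\<close>, so its signs there persist for small
    t.\<close>
  have "eventually (\<lambda>t. eval3 M a (B t) z1 * eval3 M a b0 z1 > 0) (nhds 0)"
    by (rule ev) (use sg in \<open>auto simp: B_def zero_less_mult_iff intro!: continuous_intros\<close>)
  moreover have "eventually (\<lambda>t. eval3 M a (B (- t)) z2 * eval3 M a b0 z2 > 0) (nhds 0)"
    by (rule ev) (use sg in \<open>auto simp: B_def zero_less_mult_iff intro!: continuous_intros\<close>)
  ultimately have "eventually (\<lambda>t. eval3 M a (B t) z1 * eval3 M a b0 z1 > 0 \<and>
      eval3 M a (B (- t)) z2 * eval3 M a b0 z2 > 0) (nhds 0)"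
    by (rule eventually_conj)
  then obtain d3 where d3: "d3 > 0"
      "\<And>t. \<bar>t\<bar> < d3 \<Longrightarrow> eval3 M a (B t) z1 * eval3 M a b0 z1 > 0 \<and>
        eval3 M a (B (- t)) z2 * eval3 M a b0 z2 > 0"
    unfolding eventually_nhds_metric dist_real_def by auto
  define d where "d = min d1 (min d2 d3)"
  have "d > 0" using d1 d2 d3 by (simp add: d_def)
  \<comment> \<open>Only finitely many t make the eliminant vanish on the line of abscissa
    \<open>x0\<close>; avoiding them makes the sign comparisons there strict.\<close>
  have fin: "finite (h -` {b. eval3 M a b x0 = 0})" if "inj h" for h :: "real \<Rightarrow> real"
    using finite_eval3_zeros that by (rule finite_vimageI)
  have "inj B" "inj (\<lambda>t. B (- t))"
    using s by (auto simp: inj_def B_def)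
  then have "finite (B -` {b. eval3 M a b x0 = 0} \<union> (\<lambda>t. B (- t)) -` {b. eval3 M a b x0 = 0})"
    using fin by blast
  moreover have "infinite {0<..<d}" using \<open>d > 0\<close> by simp
  ultimately have "\<not> {0<..<d} \<subseteq> B -` {b. eval3 M a b x0 = 0} \<union> (\<lambda>t. B (- t)) -` {b. eval3 M a b x0 = 0}"
    using finite_subset by blast
  then obtain t where t: "0 < t" "t < d" and nz: "eval3 M a (B t) x0 \<noteq> 0" "eval3 M a (B (- t)) x0 \<noteq> 0"
    unfolding subset_iff by auto
  have Xt: "x0 < X t'" if "0 < t'" "t' \<le> t" for t'
    using d1(2)[of t'] that t by (simp add: d_def)
  have Xt': "X (- t') < x0" if "0 < t'" "t' \<le> t" for t'
    using d2(2)[of t'] that t by (simp add: d_def)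
  have XF: "Re w = X t'" if "F w = Complex a (B t')" for w t'
    using that by (metis G_F X_def)
  have "Complex a (B t) \<notin> F ` strip z1 x0"
  proof
    assume "Complex a (B t) \<in> F ` strip z1 x0"
    then obtain w where "w \<in> strip z1 x0" "F w = Complex a (B t)" by (metis imageE)
    then show False using XF[of w t] Xt[of t] t by (auto simp: strip_def)
  qed
  then have s1: "eval3 M a (B t) z1 * eval3 M a (B t) x0 \<ge> 0"
    by (rule eval3_sign_strip) (use z in \<open>simp add: x0_def\<close>)
  have "Complex a (B (- t)) \<notin> F ` strip x0 z2"
  proof
    assume "Complex a (B (- t)) \<in> F ` strip x0 z2"
    then obtain w where "w \<in> strip x0 z2" "F w = Complex a (B (- t))" by (metis imageE)
    then show False using XF[of w "-t"] Xt'[of t] t by (auto simp: strip_def)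
  qed
  then have s2: "eval3 M a (B (- t)) x0 * eval3 M a (B (- t)) z2 \<ge> 0"
    by (rule eval3_sign_strip) (use z in \<open>simp add: x0_def\<close>)
  have "eval3 M a (B t) x0 * eval3 M a (B (- t)) x0 \<le> 0"
  proof (rule eval3_sign_flip)
    show "eval2 P x0 y0 = a" by (fact fx0)
    show "eval2 (pderiv P) x0 y0 \<noteq> 0" using fy by (simp add: x0_def y0_def)
    show "(B t - eval2 Q x0 y0) * (B (- t) - eval2 Q x0 y0) \<le> 0"
      using s by (auto simp: gx0 B_def)
    fix y assume y: "eval2 P x0 y = a" "y \<noteq> y0"
    show "(B t - eval2 Q x0 y) * (B (- t) - eval2 Q x0 y) \<ge> 0"
    proof (rule ccontr)
      assume neg: "\<not> ?thesis"
      \<comment> \<open>The time at which the path reaches the value of \<open>Q\<close> at the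
        competing root. A solution of abscissa \<open>x0\<close> occurs only at time 0, and
        injectivity then identifies it with \<open>w0\<close>.\<close>
      define v where "v = s * (eval2 Q x0 y - b0)"
      have v: "B v = eval2 Q x0 y" using s by (auto simp: B_def v_def)
      have "\<bar>v\<bar> < t" using neg s t by (auto simp: v[symmetric] B_def not_le mult_less_0_iff)
      have Fv: "F (Complex x0 y) = Complex a (B v)" using y v by simp
      then have "X v = x0" using XF[of "Complex x0 y" v] by simp
      have "v = 0"
      proof (rule ccontr)
        assume "v \<noteq> 0"
        then consider "0 < v" | "0 < - v" by linarith
        then show False
          using Xt[of v] Xt'[of "-v"] \<open>X v = x0\<close> \<open>\<bar>v\<bar> < t\<close> by cases auto
      qed
      then have "F (Complex x0 y) = F w0" using Fv w0 B0 by simp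
      then have "Complex x0 y = w0" by (rule injD[OF inj])
      then show False using y(2) by (simp add: w0_eq)
    qed
  qed
  moreover have "eval3 M a (B t) z1 * eval3 M a b0 z1 > 0" "eval3 M a (B (- t)) z2 * eval3 M a b0 z2 > 0"
    using d3(2)[of t] t by (auto simp: d_def)
  \<comment> \<open>The sign at \<open>z1\<close> equals the one at (B t, x0), which is opposite to
    the one at (B (- t), x0), which equals the sign at \<open>z2\<close>; this contradicts
    \<open>sg\<close>.\<close>
  ultimately show False
    using sg s1 s2 nz by (auto simp: zero_less_mult_iff mult_le_0_iff zero_le_mult_iff)
qed

text \<open>As M = C M', and the square of \<open>C\<close> is positive where \<open>C\<close> is
  nonzero, the sign statements pass to the primitive part off the curve C = 0. They hold everywhere
  because a strict violation would persist on an open set, which contains generic points.\<close>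

lemma parity:
  obtains M' where "content M' = 1"
    "\<And>a b. spec3 M' a b \<noteq> 0 \<Longrightarrow> odd (degree (spec3 M' a b)) \<longleftrightarrow> Complex a b \<in> range F"
proof -
  define C where "C = content M"
  define M' where "M' = primitive_part M"
  have "M \<noteq> 0"
  proof
    assume "M = 0"
    then have "{b. eval3 M 0 b 0 = 0} = UNIV" by (simp add: eval3_def)
    then show False using finite_eval3_zeros[of 0 0] infinite_UNIV_char_0[where 'a = real] by simp
  qed
  then have C: "C \<noteq> 0" and M'1: "content M' = 1" by (simp_all add: C_def M'_def)
  have "M = smult C M'" by (simp add: C_def M'_def)
  then have eval: "eval3 M a b z = eval2 C a b * eval3 M' a b z" for a b z
    by (simp add: eval3_def eval2_def)
  have P': "pderiv P \<noteq> 0" using deg by (simp add: pderiv_eq_0_iff)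
  have cont: "continuous_on S (\<lambda>w. eval3 M' (Re w) (Im w) z)" for S z
    by (intro continuous_at_imp_continuous_on ballI isCont_eval3 isCont_Re isCont_Im continuous_ident continuous_const)
  have odd: "odd (degree (spec3 M' a b))" if nz: "spec3 M' a b \<noteq> 0" and U: "Complex a b \<in> range F" for a b
  proof -
    obtain w0 where w0: "F w0 = Complex a b" using U by (metis imageE)
    show ?thesis
    proof (rule odd_degree_of_signs[OF nz, where x = "Re w0"], unfold poly_spec3, rule ccontr)
      fix z1 z2 assume z: "z1 < Re w0" "Re w0 < z2"
      assume neg: "\<not> eval3 M' a b z1 * eval3 M' a b z2 \<le> 0"
      define h where "h q = eval3 M' (Re q) (Im q) z1 * eval3 M' (Re q) (Im q) z2" for q
      have h: "continuous_on S h" for S unfolding h_def by (intro continuous_intros cont)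
      \<comment> \<open>Source points at which the violation persists. Genericity is then reached in
        two stages: \<open>C\<close> nonzero at some point of the open image of \<open>V\<close>,
        and f_y nonzero at some point of the open set V'.\<close>
      define V where "V = {w. 0 < h (F w)} \<inter> {w. z1 < Re w} \<inter> {w. Re w < z2}"
      have "open V" unfolding V_def
        by (intro open_Int open_Collect_less continuous_intros continuous_on_compose2[OF h continuous_on_F]) auto
      moreover have "w0 \<in> V" using neg z by (simp add: V_def h_def w0 not_le)
      ultimately have "open (F ` V)" "F ` V \<noteq> {}" using open_image_F by auto
      then obtain q where q: "q \<in> F ` V" "eval2 C (Re q) (Im q) \<noteq> 0"
        using eval2_nonzero_dense[OF C] by blast
      define V' where "V' = V \<inter> {w. eval2 C (Re (F w)) (Im (F w)) \<noteq> 0}"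
      have "open V'" unfolding V'_def
        by (intro open_Int \<open>open V\<close> open_Collect_neq continuous_intros continuous_on_F)
      moreover have "V' \<noteq> {}" using q by (auto simp: V'_def)
      ultimately obtain w where w: "w \<in> V'" "eval2 (pderiv P) (Re w) (Im w) \<noteq> 0"
        using eval2_nonzero_dense[OF P'] by blast
      have "F w = Complex (Re (F w)) (Im (F w))" by simp
      then have "eval3 M (Re (F w)) (Im (F w)) z1 * eval3 M (Re (F w)) (Im (F w)) z2 \<le> 0"
        by (rule eval3_sign_flip_generic) (use w in \<open>auto simp: V'_def V_def\<close>)
      also have "eval3 M (Re (F w)) (Im (F w)) z1 * eval3 M (Re (F w)) (Im (F w)) z2 =
          (eval2 C (Re (F w)) (Im (F w)))\<^sup>2 * h (F w)"
        by (simp add: eval h_def power2_eq_square mult_ac)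
      finally show False using w(1) by (auto simp: V'_def V_def mult_le_0_iff)
    qed
  qed
  have even: "even (degree (spec3 M' a b))" if nz: "spec3 M' a b \<noteq> 0" and U: "Complex a b \<notin> range F" for a b
  proof (rule even_degree_of_signs[OF nz], unfold poly_spec3, rule ccontr)
    fix z1 z2 :: real assume z: "z1 \<le> z2"
    assume neg: "\<not> eval3 M' a b z1 * eval3 M' a b z2 \<ge> 0"
    define h where "h q = eval3 M' (Re q) (Im q) z1 * eval3 M' (Re q) (Im q) z2" for q
    have h: "continuous_on S h" for S unfolding h_def by (intro continuous_intros cont)
    \<comment> \<open>Both the violation and the absence of solutions in the strip are open
      conditions, the latter because the image of the strip is closed.\<close>
    define V where "V = {q. h q < 0} \<inter> - (F ` strip z1 z2)"
    have "open V" unfolding V_def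
      by (intro open_Int open_Collect_less h continuous_intros open_Compl closed_image_strip)
    moreover have "Complex a b \<in> V" using neg U by (auto simp: V_def h_def not_le)
    ultimately obtain q where q: "q \<in> V" "eval2 C (Re q) (Im q) \<noteq> 0"
      using eval2_nonzero_dense[OF C] by blast
    have "Complex (Re q) (Im q) \<notin> F ` strip z1 z2" using q by (auto simp: V_def)
    then have "0 \<le> eval3 M (Re q) (Im q) z1 * eval3 M (Re q) (Im q) z2"
      using z by (rule eval3_sign_strip)
    also have "\<dots> = (eval2 C (Re q) (Im q))\<^sup>2 * h q"
      by (simp add: eval h_def power2_eq_square mult_ac)
    finally show False using q by (auto simp: V_def zero_le_mult_iff)
  qed
  show thesis using that[OF M'1] odd even by blast
qed

end

section \<open>Surjectivity\<close>

lemma dvd_smult_of_min_degree: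
  fixes h X :: "real poly poly"
  assumes h: "h \<noteq> 0" and X: "X = u * p + v * A" and hI: "h = u0 * p + v0 * A"
      and min: "\<And>g u v. g \<noteq> 0 \<Longrightarrow> g = u * p + v * A \<Longrightarrow> degree h \<le> degree g"
  obtains l where "l \<noteq> 0" "h dvd [:l:] * X"
proof -
  \<comment> \<open>Pseudo-division stays inside polynomials in x at the price of the factor
    \<open>l\<close>; the remainder lies in the ideal of \<open>p\<close> and \<open>A\<close>, so
    the minimal degree of \<open>h\<close> forces it to vanish.\<close>
  obtain q r where qr: "pseudo_divmod X h = (q, r)" by fastforce
  define l where "l = lead_coeff h ^ (Suc (degree X) - degree h)"
  have eq: "smult l X = h * q + r" and r: "r = 0 \<or> degree r < degree h"
    using pseudo_divmod[OF h qr] by (simp_all add: l_def)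
  have "r = [:l:] * X - h * q" using eq by simp
  also have "\<dots> = ([:l:] * u - u0 * q) * p + ([:l:] * v - v0 * q) * A"
    unfolding X hI by (simp only: algebra_simps)
  finally have "r = 0" using r min leD by blast
  then have "h dvd [:l:] * X" using eq by simp
  moreover have "l \<noteq> 0" using h by (simp add: l_def)
  ultimately show thesis using that by blast
qed

text \<open>An element \<open>h\<close> of least degree in y in the ideal of \<open>p\<close> and
  \<open>A\<close> divides both up to factors in x. Since \<open>p\<close> is prime and divides h q,
  it divides \<open>h\<close> or \<open>q\<close>, and either case contradicts a positive degree of
  \<open>h\<close>.\<close>

lemma ideal_contains_constant:
  fixes p A :: "real poly poly"
  assumes p: "prime_elem p" and A: "\<not> p dvd A"
  obtains r u v where "r \<noteq> 0" "[:r:] = u * p + v * A"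
proof -
  define I where "I g \<longleftrightarrow> g \<noteq> 0 \<and> (\<exists>u v. g = u * p + v * A)" for g
  have "p \<noteq> 0" using p by auto
  moreover have "p = 1 * p + 0 * A" by simp
  ultimately have Ip: "I p" unfolding I_def by blast
  obtain h where h: "I h" "\<And>g. I g \<Longrightarrow> degree h \<le> degree g"
    using ex_has_least_nat[of I p degree] Ip by blast
  obtain u0 v0 where h0: "h \<noteq> 0" "h = u0 * p + v0 * A" using h(1) by (auto simp: I_def)
  have min: "degree h \<le> degree g" if "g \<noteq> 0" "g = u * p + v * A" for g u v
    using that by (intro h(2)) (auto simp: I_def)
  have "degree h = 0"
  proof (rule ccontr)
    assume dh: "degree h \<noteq> 0"
    have e: "p = 1 * p + 0 * A" "A = 0 * p + 1 * A" by simp_all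
    obtain l where l: "l \<noteq> 0" "h dvd [:l:] * p"
      by (rule dvd_smult_of_min_degree[OF h0(1) e(1) h0(2) min])
    obtain l' where l': "l' \<noteq> 0" "h dvd [:l':] * A"
      by (rule dvd_smult_of_min_degree[OF h0(1) e(2) h0(2) min])
    from l(2) obtain q where q: "[:l:] * p = h * q" by (rule dvdE)
    then have "p dvd h * q" by (metis dvd_triv_right)
    then consider "p dvd h" | "p dvd q" using prime_elem_dvd_multD[OF p] by blast
    then show False
    proof cases
      case 1
      then have "p dvd [:l':] * A" using l'(2) by (rule dvd_trans)
      then have "p dvd [:l':]" using prime_elem_dvd_multD[OF p] A by blast
      then have "degree p \<le> degree [:l':]" by (rule dvd_imp_degree_le) (use l' in simp)
      then show False using h(2)[OF Ip] dh by simp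
    next
      case 2
      then obtain t where "q = p * t" by (rule dvdE)
      then have "p * [:l:] = p * (h * t)" using q by (simp only: mult_ac)
      then have ht: "[:l:] = h * t" using p by (subst (asm) mult_cancel_left) auto
      then have "t \<noteq> 0" using l(1) by auto
      then have "degree (h * t) = degree h + degree t" using h0(1) by (intro degree_mult_eq)
      then show False using dh by (simp add: ht[symmetric] del: mult_pCons_left mult_pCons_right)
    qed
  qed
  then obtain r where r: "h = [:r:]" by (rule degree_eq_zeroE)
  then show thesis using that[of r u0 v0] h0 by auto
qed

lemma spec2_eq_0_iff: "spec2 A x = 0 \<longleftrightarrow> [:[:-x, 1:]:] dvd A"
proof -
  have "spec2 A x = 0 \<longleftrightarrow> (\<forall>n. poly (coeff A n) x = 0)"
    by (simp add: poly_eq_iff)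
  also have "\<dots> \<longleftrightarrow> [:[:-x, 1:]:] dvd A"
    by (simp add: const_poly_dvd_iff poly_eq_0_iff_dvd)
  finally show ?thesis .
qed

text \<open>Elimination of y leaves finitely many abscissae, the zeros of \<open>r\<close>. A
  vertical line with infinitely many common zeros would be a component of both curves.\<close>

lemma finite_common_zeros:
  fixes p A :: "real poly poly"
  assumes p: "prime_elem p" and A: "\<not> p dvd A"
  shows "finite {w. eval2 p (Re w) (Im w) = 0 \<and> eval2 A (Re w) (Im w) = 0}"
proof -
  let ?Z = "{w. eval2 p (Re w) (Im w) = 0 \<and> eval2 A (Re w) (Im w) = 0}"
  obtain r u v where r: "r \<noteq> 0" "[:r:] = u * p + v * A"
    using ideal_contains_constant[OF p A] by blast
  have fin: "finite {y. eval2 p x y = 0 \<and> eval2 A x y = 0}" for x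
  proof -
    let ?l = "[:[:-x, 1:]:]"
    have "\<not> (spec2 p x = 0 \<and> spec2 A x = 0)"
    proof
      assume "spec2 p x = 0 \<and> spec2 A x = 0"
      then have dvd: "?l dvd p" "?l dvd A" by (simp_all add: spec2_eq_0_iff)
      from dvd(1) obtain t where t: "p = ?l * t" by (rule dvdE)
      \<comment> \<open>The linear factor divides \<open>A\<close> while \<open>p\<close> does not,
        so \<open>p\<close> cannot divide it. By primality \<open>p\<close> divides the cofactor
        \<open>t\<close>, and cancelling makes the linear factor a unit.\<close>
      have "\<not> p dvd ?l" using A dvd(2) dvd_trans by blast
      then have "p dvd t" using prime_elem_dvd_multD[OF p, of ?l t] t by (metis dvd_refl)
      then obtain s where "t = p * s" by (rule dvdE)
      then have "p * 1 = p * (?l * s)" using t by (metis mult.left_commute mult_1_right)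
      then have "1 = ?l * s" using p by (subst (asm) mult_cancel_left) auto
      then have "?l dvd 1" by (rule dvdI)
      then have "[:-x, 1:] dvd 1" by (simp only: is_unit_const_poly_iff)
      then show False by (simp add: is_unit_pCons_iff)
    qed
    then consider "spec2 p x \<noteq> 0" | "spec2 A x \<noteq> 0" by blast
    then show ?thesis
    proof cases
      case 1
      from poly_roots_finite[OF this] show ?thesis by (rule rev_finite_subset) (auto simp: poly_spec2)
    next
      case 2
      from poly_roots_finite[OF this] show ?thesis by (rule rev_finite_subset) (auto simp: poly_spec2)
    qed
  qed
  have "?Z \<subseteq> (\<Union>x\<in>{x. poly r x = 0}. Complex x ` {y. eval2 p x y = 0 \<and> eval2 A x y = 0})"
  proof
    fix w assume w: "w \<in> ?Z"
    have "poly r (Re w) = eval2 [:r:] (Re w) (Im w)" by simp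
    also have "\<dots> = 0" unfolding r(2) using w by (simp only: eval2_simps) simp
    finally show "w \<in> (\<Union>x\<in>{x. poly r x = 0}. Complex x ` {y. eval2 p x y = 0 \<and> eval2 A x y = 0})"
      using w by (auto intro!: bexI[of _ "Re w"] image_eqI[of _ _ "Im w"])
  qed
  moreover have "finite (\<Union>x\<in>{x. poly r x = 0}. Complex x ` {y. eval2 p x y = 0 \<and> eval2 A x y = 0})"
    using poly_roots_finite[OF r(1)] fin by auto
  ultimately show ?thesis by (rule finite_subset)
qed

lemma pderiv_eval_inner: "pderiv (poly P [:y:]) = poly (map_poly pderiv P) [:y:]"
  by (induction P) (simp_all add: map_poly_pCons pderiv_add pderiv_mult pderiv_smult pderiv_pCons)

text \<open>A prime polynomial vanishing at infinitely many points changes sign: otherwise these zeros would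
  also be zeros of its partial derivatives, which therefore it would divide.\<close>

lemma semidefinite_prime_finite_zeros:
  fixes p :: "real poly poly"
  assumes p: "prime_elem p"
      and sgn: "(\<forall>x y. eval2 p x y \<ge> 0) \<or> (\<forall>x y. eval2 p x y \<le> 0)"
  shows "finite {w. eval2 p (Re w) (Im w) = 0}"
proof (rule ccontr)
  assume inf: "infinite {w. eval2 p (Re w) (Im w) = 0}"
  have crit: "l = 0" if "DERIV h t :> l" "h t = 0" "(\<forall>s. h s \<ge> 0) \<or> (\<forall>s. h s \<le> 0)"
    for h :: "real \<Rightarrow> real" and t l
    using that(3) DERIV_local_min[OF that(1), of 1] DERIV_local_max[OF that(1), of 1] that(2) by auto
  have dy: "eval2 (pderiv p) x y = 0" if "eval2 p x y = 0" for x y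
  proof (rule crit)
    have "pderiv (spec2 p x) = spec2 (pderiv p) x"
      by (rule poly_eqI) (simp add: coeff_pderiv)
    then show "((\<lambda>t. eval2 p x t) has_real_derivative eval2 (pderiv p) x y) (at y)"
      using poly_DERIV[of "spec2 p x" y] by (simp add: poly_spec2)
  qed (use that sgn in auto)
  have dx: "eval2 (map_poly pderiv p) x y = 0" if "eval2 p x y = 0" for x y
  proof (rule crit)
    show "((\<lambda>t. eval2 p t y) has_real_derivative eval2 (map_poly pderiv p) x y) (at x)"
      using poly_DERIV[of "poly p [:y:]" x] by (simp add: eval2_def pderiv_eval_inner)
  qed (use that sgn in auto)
  have dvd: "p dvd A" if "\<And>x y. eval2 p x y = 0 \<Longrightarrow> eval2 A x y = 0" for A
  proof (rule ccontr)
    assume "\<not> p dvd A"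
    then have "finite {w. eval2 p (Re w) (Im w) = 0 \<and> eval2 A (Re w) (Im w) = 0}"
      by (rule finite_common_zeros[OF p])
    also have "{w. eval2 p (Re w) (Im w) = 0 \<and> eval2 A (Re w) (Im w) = 0} = {w. eval2 p (Re w) (Im w) = 0}"
      using that by blast
    finally show False using inf by blast
  qed
  \<comment> \<open>Comparing degrees removes first the dependence of \<open>p\<close> on y and then
    that on x; what remains is a nonzero constant, hence a unit.\<close>
  have "pderiv p = 0"
  proof (rule ccontr)
    assume nz: "pderiv p \<noteq> 0"
    have "degree p \<le> degree (pderiv p)" using dvd[OF dy] nz by (rule dvd_imp_degree_le)
    then show False using nz by (simp add: degree_pderiv pderiv_eq_0_iff)
  qed
  then have "degree p = 0" by (simp add: pderiv_eq_0_iff)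
  then obtain r where r: "p = [:r:]" by (rule degree_eq_zeroE)
  have "[:r:] dvd map_poly pderiv [:r:]" using dvd[OF dx] unfolding r by blast
  then have rdvd: "r dvd pderiv r" by (simp add: map_poly_pCons)
  have "pderiv r = 0"
  proof (rule ccontr)
    assume nz: "pderiv r \<noteq> 0"
    have "degree r \<le> degree (pderiv r)" using rdvd nz by (rule dvd_imp_degree_le)
    then show False using nz by (simp add: degree_pderiv pderiv_eq_0_iff)
  qed
  then have "degree r = 0" by (simp add: pderiv_eq_0_iff)
  then obtain k where k: "r = [:k:]" by (rule degree_eq_zeroE)
  have "k \<noteq> 0" using p by (auto simp: r k)
  then have "p dvd 1" by (simp add: r k is_unit_const_poly_iff is_unit_pCons_iff)
  then show False using p by auto
qed

lemma eval2_prod_mset: "eval2 (prod_mset S) x y = (\<Prod>p\<in>#S. eval2 p x y)"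
  by (induction S) simp_all

text \<open>Pigeonhole over the finitely many prime factors of \<open>A\<close>.\<close>

lemma prime_factor_with_infinite_zeros:
  fixes A :: "real poly poly"
  assumes A: "A \<noteq> 0" and Z: "infinite Z" "\<And>w. w \<in> Z \<Longrightarrow> eval2 A (Re w) (Im w) = 0"
  obtains p where "prime_elem p" "infinite {w\<in>Z. eval2 p (Re w) (Im w) = 0}"
proof -
  obtain S where S: "\<And>p. p \<in># S \<Longrightarrow> prime_elem p" "normalize (prod_mset S) = normalize A"
    using prime_factorization_exists[OF A] by blast
  have "A dvd prod_mset S" using associatedD1[OF S(2)[symmetric]] .
  then obtain k where k: "prod_mset S = A * k" by (rule dvdE)
  have "Z \<subseteq> (\<Union>p\<in>set_mset S. {w\<in>Z. eval2 p (Re w) (Im w) = 0})"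
  proof
    fix w assume w: "w \<in> Z"
    have "eval2 (prod_mset S) (Re w) (Im w) = 0" unfolding k using Z(2)[OF w] by simp
    then show "w \<in> (\<Union>p\<in>set_mset S. {w\<in>Z. eval2 p (Re w) (Im w) = 0})"
      using w by (auto simp: eval2_prod_mset prod_mset_zero_iff)
  qed
  then have "infinite (\<Union>p\<in>set_mset S. {w\<in>Z. eval2 p (Re w) (Im w) = 0})"
    using Z(1) finite_subset by blast
  then obtain p where "p \<in># S" "infinite {w\<in>Z. eval2 p (Re w) (Im w) = 0}" by auto
  with S(1) show thesis using that by blast
qed

section \<open>From parity to surjectivity\<close>

lemma infinite_complement_simply_connected:
  fixes U :: "complex set"
  assumes "open U" "simply_connected U" "U \<noteq> UNIV"
  shows "infinite (- U)"
proof
  assume fin: "finite (- U)"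
  \<comment> \<open>Components of the complement of an open simply connected plane set are
    unbounded, which a finite complement does not allow.\<close>
  obtain q where "q \<in> - U" using assms(3) by blast
  then have C: "connected_component_set (- U) q \<in> components (- U)"
    by (auto simp: components_def)
  then have "\<not> bounded (connected_component_set (- U) q)"
    using assms simply_connected_eq_unbounded_complement_components by blast
  moreover have "bounded (connected_component_set (- U) q)"
    using fin in_components_subset[OF C] by (meson finite_imp_bounded bounded_subset)
  ultimately show False by blast
qed

lemma parity_imp_UNIV:
  fixes U :: "complex set" and M :: "real poly poly poly"
  assumes U: "open U" "simply_connected U" "U \<noteq> {}"
      and content: "content M = 1"
      and parity: "\<And>a b. spec3 M a b \<noteq> 0 \<Longrightarrow> odd (degree (spec3 M a b)) \<longleftrightarrow> Complex a b \<in> U"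
  shows "U = UNIV"
proof (rule ccontr)
  assume "U \<noteq> UNIV"
  then have inf: "infinite (- U)" by (rule infinite_complement_simply_connected[OF U(1,2)])
  define ev where "ev A w = eval2 A (Re w) (Im w)" for A :: "real poly poly" and w
  define A where "A = coeff M"
  have cont_ev: "continuous_on S (ev p)" for S p unfolding ev_def by (intro continuous_intros)
  \<comment> \<open>The highest coefficient that does not vanish at \<open>w\<close> gives the
    degree of the specialized polynomial.\<close>
  have parity': "odd k \<longleftrightarrow> w \<in> U" if "ev (A k) w \<noteq> 0" "\<And>i. i > k \<Longrightarrow> ev (A i) w = 0" for k w
  proof -
    let ?m = "spec3 M (Re w) (Im w)"
    have c: "coeff ?m i = ev (A i) w" for i by (simp add: ev_def A_def)
    then have "degree ?m \<le> k" by (intro degree_le) (simp add: that(2))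
    moreover have "k \<le> degree ?m" using c that(1) by (intro le_degree) simp
    ultimately have "degree ?m = k" by simp
    moreover have "?m \<noteq> 0" using c that(1) by (metis coeff_0)
    ultimately show ?thesis using parity[of "Re w" "Im w"] by simp
  qed
  define N where "N = degree M"
  have "M \<noteq> 0" using content by auto
  then have AN: "A N \<noteq> 0" by (simp add: A_def N_def)
  have AN': "A i = 0" if "i > N" for i using that by (simp add: A_def N_def coeff_eq_0)
  have parN: "odd N \<longleftrightarrow> w \<in> U" if "ev (A N) w \<noteq> 0" for w
    using that by (intro parity') (auto simp: AN' ev_def)
  have "odd N"
  proof -
    obtain w where "w \<in> U" "ev (A N) w \<noteq> 0"
      using eval2_nonzero_dense[OF AN U(1,3)] unfolding ev_def by blast
    then show ?thesis using parN by blast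
  qed
  with parN have in_U: "w \<in> U" if "ev (A N) w \<noteq> 0" for w using that by blast
  obtain p where p: "prime_elem p" "infinite {w\<in>- U. ev p w = 0}"
    using prime_factor_with_infinite_zeros[OF AN inf] in_U unfolding ev_def by blast
  \<comment> \<open>Content 1 ensures that \<open>p\<close> does not divide all coefficients; the
    largest index \<open>k\<close> in \<open>J\<close> is then the degree in z at all but finitely
    many zeros of \<open>p\<close>.\<close>
  define J where "J = {i. \<not> p dvd A i}"
  have "J \<subseteq> {..N}" using AN' by (force simp: J_def not_le[symmetric])
  then have "finite J" using finite_subset by blast
  have "J \<noteq> {}"
  proof
    assume "J = {}"
    then have "[:p:] dvd M" by (simp add: const_poly_dvd_iff J_def A_def)
    then have "p dvd 1" using content by (simp add: const_poly_dvd_iff_dvd_content)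
    then show False using p(1) by auto
  qed
  define k where "k = Max J"
  have "k \<in> J" using \<open>finite J\<close> \<open>J \<noteq> {}\<close> by (simp add: k_def)
  then have pk: "\<not> p dvd A k" by (simp add: J_def)
  have high: "ev (A i) w = 0" if "i > k" "ev p w = 0" for i w
  proof -
    have "i \<notin> J" using that(1) \<open>finite J\<close> by (auto simp: k_def dest: Max_ge)
    then obtain t where "A i = p * t" by (auto simp: J_def elim: dvdE)
    then show ?thesis using that(2) by (simp add: ev_def)
  qed
  define K where "K = {w. ev p w = 0 \<and> ev (A k) w = 0}"
  have finK: "finite K" unfolding K_def ev_def by (rule finite_common_zeros[OF p(1) pk])
  have park: "odd k \<longleftrightarrow> w \<in> U" if "ev p w = 0" "w \<notin> K" for w
    using that by (intro parity') (auto simp: K_def high)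
  \<comment> \<open>The curve p = 0 has a point outside both \<open>U\<close> and the finite set
    \<open>K\<close>, which forces \<open>k\<close> to be even; by the same parity no zero of
    \<open>p\<close> lies in U - K.\<close>
  have "\<not> {w\<in>- U. ev p w = 0} \<subseteq> K" using p(2) finK finite_subset by blast
  then obtain w where "w \<in> - U" "ev p w = 0" "w \<notin> K" by blast
  then have "even k" using park by blast
  then have nz: "ev p w \<noteq> 0" if "w \<in> U - K" for w using park that by blast
  have "connected (U - K)"
    by (rule connected_open_diff_countable)
      (use U finK in \<open>auto simp: simply_connected_imp_connected uncountable_infinite countable_finite\<close>)
  then have conn: "connected (ev p ` (U - K))"
    by (rule connected_continuous_image[OF cont_ev])
  have sgn: "(\<forall>w\<in>U - K. ev p w \<ge> 0) \<or> (\<forall>w\<in>U - K. ev p w \<le> 0)"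
  proof (rule ccontr)
    assume "\<not> ?thesis"
    then obtain w1 w2 where "w1 \<in> U - K" "w2 \<in> U - K" "ev p w1 < 0" "ev p w2 > 0"
      by (auto simp: not_le)
    then have "0 \<in> ev p ` (U - K)"
      using connectedD_interval[OF conn, of "ev p w1" "ev p w2" 0] by auto
    then show False using nz by auto
  qed
  have dense: "\<exists>w\<in>V. w \<in> U - K" if V: "open V" "V \<noteq> {}" for V
  proof -
    \<comment> \<open>Where this product is nonzero the point lies in \<open>U\<close> because of
      the first factor and outside \<open>K\<close> because of the second.\<close>
    have "A N * A k \<noteq> 0" using AN pk by auto
    then obtain w where "w \<in> V" "eval2 (A N * A k) (Re w) (Im w) \<noteq> 0"
      using eval2_nonzero_dense V by blast
    then show ?thesis using in_U by (auto simp: ev_def K_def)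
  qed
  have "(\<forall>x y. eval2 p x y \<ge> 0) \<or> (\<forall>x y. eval2 p x y \<le> 0)"
    using sgn
  proof
    assume pos: "\<forall>w\<in>U - K. ev p w \<ge> 0"
    have "open {w. ev p w < 0}" by (intro open_Collect_less cont_ev continuous_intros)
    then have "{w. ev p w < 0} = {}" using dense pos by force
    then have "ev p (Complex x y) \<ge> 0" for x y by (auto simp: not_less)
    then show ?thesis by (simp add: ev_def)
  next
    assume neg: "\<forall>w\<in>U - K. ev p w \<le> 0"
    have "open {w. 0 < ev p w}" by (intro open_Collect_less cont_ev continuous_intros)
    then have "{w. 0 < ev p w} = {}" using dense neg by force
    then have "ev p (Complex x y) \<le> 0" for x y by (auto simp: not_less)
    then show ?thesis by (simp add: ev_def)
  qed
  then have "finite {w. ev p w = 0}"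
    unfolding ev_def by (rule semidefinite_prime_finite_zeros[OF p(1)])
  then show False using p(2) by (simp add: finite_subset)
qed

context inj_map
begin

lemma range_F: "range F = UNIV"
proof -
  obtain M' where "content M' = 1"
    "\<And>a b. spec3 M' a b \<noteq> 0 \<Longrightarrow> odd (degree (spec3 M' a b)) \<longleftrightarrow> Complex a b \<in> range F"
    using parity by blast
  moreover have "open (range F)" by (rule open_image_F) simp
  moreover have "simply_connected (range F)"
  proof (rule homeomorphic_simply_connected)
    show "(UNIV :: complex set) homeomorphic range F"
      by (rule invariance_of_domain_homeomorphic[OF _ continuous_on_F _ inj]) auto
    show "simply_connected (UNIV :: complex set)"
      by (intro convex_imp_simply_connected convex_UNIV)
  qed
  ultimately show ?thesis using parity_imp_UNIV by blast
qed

end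

section \<open>Shearing to a monic first component\<close>

definition planar :: "real poly poly \<Rightarrow> real poly poly \<Rightarrow> complex \<Rightarrow> complex" where
  "planar P Q w = Complex (eval2 P (Re w) (Im w)) (eval2 Q (Re w) (Im w))"

lemma continuous_on_planar: "continuous_on S (planar P Q)"
  unfolding planar_def Complex_eq by (intro continuous_intros)

definition lift_outer :: "real poly \<Rightarrow> real poly poly" where
  "lift_outer q = map_poly (\<lambda>c. [:c:]) q"

lemma coeff_lift_outer [simp]: "coeff (lift_outer q) n = [:coeff q n:]"
  by (simp add: lift_outer_def coeff_map_poly)

lemma eval2_lift_outer [simp]: "eval2 (lift_outer q) x y = poly q y"
  by (induction q) (simp_all add: lift_outer_def map_poly_pCons)

lemma degree_lift_outer [simp]: "degree (lift_outer q) = degree q"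
  unfolding lift_outer_def by (rule degree_map_poly) simp

lemma eval2_monom_1 [simp]: "eval2 (monom 1 n) x y = y ^ n"
  by (simp add: eval2_def poly_monom)

lemma eval2_smult [simp]: "eval2 (smult q P) x y = poly q x * eval2 P x y"
  by (simp add: eval2_def)

lemma ex_swap: "\<exists>P'. \<forall>x y. eval2 P' x y = eval2 P y x"
proof (induction P)
  case (pCons q P)
  then obtain P' where "\<And>x y. eval2 P' x y = eval2 P y x" by blast
  then show ?case
    by (intro exI[of _ "lift_outer q + [:[:0, 1:]:] * P'"]) simp
qed (auto intro: exI[of _ 0])

lemma ex_twist: "\<exists>R. \<forall>x y. eval2 R x y = eval2 P (x + y ^ n) y"
proof -
  \<comment> \<open>Proved with the variables exchanged, since the induction runs over the outer
    variable, which is the one being replaced.\<close>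
  have "\<exists>R. \<forall>x y. eval2 R x y = eval2 P y (x + y ^ n)" for P
  proof (induction P)
    case (pCons q P)
    then obtain R where "\<And>x y. eval2 R x y = eval2 P y (x + y ^ n)" by blast
    then show ?case
      by (intro exI[of _ "lift_outer q + (monom 1 n + [:[:0, 1:]:]) * R"])
        (simp add: algebra_simps)
  qed (auto intro: exI[of _ 0])
  then show ?thesis using ex_swap[of P] by metis
qed

text \<open>For large \<open>n\<close> the leading power of \<open>x\<close> determines the leading term in \<open>y\<close> after the
  substitution.\<close>

lemma ex_twist_monic:
  assumes "n \<ge> 1" "\<And>i. degree (coeff P i) < n" "P \<noteq> 0"
  shows "\<exists>R c. (\<forall>x y. eval2 R x y = eval2 P y (x + y ^ n)) \<and> lead_coeff R = [:c:] \<and> c \<noteq> 0"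
  using assms(2,3)
proof (induction P)
  case 0
  then show ?case by simp
next
  case (pCons q P)
  show ?case
  proof (cases "P = 0")
    case True
    then have "q \<noteq> 0" using pCons by simp
    then show ?thesis using True
      by (intro exI[of _ "lift_outer q"] exI[of _ "lead_coeff q"]) simp
  next
    case False
    have "degree (coeff P i) < n" for i using pCons.prems(1)[of "Suc i"] by simp
    then obtain R c where R: "\<And>x y. eval2 R x y = eval2 P y (x + y ^ n)" "lead_coeff R = [:c:]" "c \<noteq> 0"
      using pCons.IH False by blast
    define T where "T = monom 1 n + [:[:0, 1 :: real:]:]"
    have T: "degree T = n" unfolding T_def
      using assms(1) by (subst degree_add_eq_left) (simp_all add: degree_monom_eq)
    have lT: "lead_coeff T = 1"
      unfolding T using assms(1) by (simp add: T_def coeff_pCons split: nat.split)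
    have "R \<noteq> 0" "T \<noteq> 0" using R lT by auto
    then have "degree (T * R) = n + degree R" by (simp add: degree_mult_eq T)
    moreover have "degree q < n" using pCons.prems(1)[of 0] by simp
    \<comment> \<open>No cancellation: \<open>T\<close> alone has degree n in y, more than the
      degree of \<open>q\<close>.\<close>
    ultimately have less: "degree (lift_outer q) < degree (T * R)" by simp
    have "lead_coeff (lift_outer q + T * R) = lead_coeff (T * R)"
      using less by (simp add: degree_add_eq_right coeff_eq_0)
    also have "\<dots> = [:c:]" by (simp add: lead_coeff_mult lT R(2))
    finally have "lead_coeff (lift_outer q + T * R) = [:c:]" .
    moreover have "eval2 (lift_outer q + T * R) x y = eval2 (pCons q P) y (x + y ^ n)" for x y
      by (simp add: R(1) T_def algebra_simps)
    ultimately show ?thesis using R(3) by blast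
  qed
qed

lemma ex_monic_coordinates:
  assumes "P \<noteq> 0"
  obtains R n c where "\<And>x y. eval2 R x y = eval2 P (x + y ^ n) y" "lead_coeff R = [:c:]" "c \<noteq> 0"
proof -
  obtain P' where P': "\<And>x y. eval2 P' x y = eval2 P y x" using ex_swap by blast
  have "P' \<noteq> 0"
  proof
    assume "P' = 0"
    then have "eval2 P x y = 0" for x y using P'[of y x] by simp
    then show False using eval2_nonzero_dense[OF assms, of UNIV] by auto
  qed
  \<comment> \<open>\<open>Suc\<close> makes n exceed every coefficient degree and also ensures n >=
    1.\<close>
  define n where "n = Suc (Max ((\<lambda>i. degree (coeff P' i)) ` {..degree P'}))"
  have "degree (coeff P' i) < n" for i
  proof (cases "i \<le> degree P'")
    case True
    then show ?thesis unfolding n_def less_Suc_eq_le by (intro Max_ge) auto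
  next
    case False
    then show ?thesis by (simp add: coeff_eq_0 n_def)
  qed
  then obtain R c where "\<forall>x y. eval2 R x y = eval2 P' y (x + y ^ n)" "lead_coeff R = [:c:]" "c \<noteq> 0"
    using ex_twist_monic[of n P'] \<open>P' \<noteq> 0\<close> by (auto simp: n_def)
  then show thesis using that[of R n c] P' by simp
qed

text \<open>The shear \<open>\<phi>\<close> is a polynomial bijection of the plane with injective
  derivative, so the sheared map satisfies the assumptions of \<open>inj_map\<close>; its range is
  contained in that of the original map.\<close>

lemma injective_planar_surjective:
  assumes inj: "inj (planar P Q)"
      and der: "\<And>w. \<exists>L. (planar P Q has_derivative L) (at w) \<and> inj L"
  shows "surj (planar P Q)"
proof -
  let ?K = "planar P Q"
  \<comment> \<open>By invariance of domain the range is open, so the first component is not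
    constant; this provides the positive degree of \<open>R\<close>.\<close>
  have nonconst: "\<exists>x y. eval2 P x y \<noteq> k" for k
  proof (rule ccontr)
    assume "\<nexists>x y. eval2 P x y \<noteq> k"
    then have "Re w = k" if "w \<in> range ?K" for w using that by (auto simp: planar_def)
    moreover have "open (range ?K)"
      by (rule invariance_of_domain[OF continuous_on_planar open_UNIV inj])
    then obtain e where "e > 0" "ball (?K 0) e \<subseteq> range ?K" using open_contains_ball by blast
    moreover have "?K 0 + of_real (e/2) \<in> ball (?K 0) e" using \<open>e > 0\<close> by (simp add: dist_norm)
    ultimately have "Re (?K 0 + of_real (e/2)) = Re (?K 0)" by (metis rangeI subsetD)
    then show False using \<open>e > 0\<close> by simp
  qed
  have "P \<noteq> 0" using nonconst[of 0] by auto
  obtain R n c where R: "\<And>x y. eval2 R x y = eval2 P (x + y ^ n) y"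
      and lead: "lead_coeff R = [:c:]" "c \<noteq> 0"
    by (rule ex_monic_coordinates[OF \<open>P \<noteq> 0\<close>]) (rule that)
  obtain S where S: "\<And>x y. eval2 S x y = eval2 Q (x + y ^ n) y" using ex_twist by blast
  define \<phi> where "\<phi> w = Complex (Re w + Im w ^ n) (Im w)" for w
  have comp: "planar R S = ?K \<circ> \<phi>"
    by (simp add: fun_eq_iff planar_def \<phi>_def R S)
  have deg: "degree R \<ge> 1"
  proof (rule ccontr)
    assume "\<not> degree R \<ge> 1"
    then obtain r where "R = [:r:]" by (metis degree_eq_zeroE less_one not_le)
    then have "R = [:[:c:]:]" using lead(1) by simp
    then have "eval2 P x y = c" for x y using R[of "x - y ^ n" y] by simp
    then show False using nonconst by blast
  qed
  obtain M where M: "\<And>a b z. complex_of_real (eval3 M a b z) =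
           (\<Prod>y\<in>#croots R a z. (of_real b - poly (cspec S z) y))"
    using elimination_polynomial[OF lead deg] by blast
  interpret monic_map R S c M
    using lead deg M by unfold_locales
  have F: "F = ?K \<circ> \<phi>"
    unfolding comp[symmetric] by (simp add: fun_eq_iff F_def planar_def)
  interpret inj_map R S c M
  proof unfold_locales
    have "inj \<phi>" by (auto simp: inj_def \<phi>_def complex_eq_iff)
    then show "inj F" unfolding F using inj by (rule inj_compose[rotated])
    fix w
    define \<phi>' where "\<phi>' h = Complex (Re h + real n * Im w ^ (n - 1) * Im h) (Im h)" for h
    have \<phi>': "(\<phi> has_derivative \<phi>') (at w)"
      unfolding \<phi>_def \<phi>'_def Complex_eq
      by (auto intro!: derivative_eq_intros simp: fun_eq_iff algebra_simps)
    obtain L where L: "(?K has_derivative L) (at (\<phi> w))" "inj L" using der by blast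
    have "(F has_derivative (\<lambda>h. L (\<phi>' h))) (at w)"
      unfolding F comp_def using \<phi>' L(1) by (rule has_derivative_compose)
    moreover have "inj \<phi>'" by (auto simp: inj_def \<phi>'_def complex_eq_iff)
    then have "inj (\<lambda>h. L (\<phi>' h))" using inj_compose[OF L(2)] by (simp add: comp_def)
    ultimately show "\<exists>L. (F has_derivative L) (at w) \<and> inj L" by blast
  qed
  show ?thesis using range_F unfolding F by (metis comp_surj fun.set_map image_comp subset_antisym subset_UNIV image_mono)
qed

section \<open>Proper local homeomorphisms\<close>

lemma proper_imp_closed_map:
  fixes F :: "'a::euclidean_space \<Rightarrow> 'a"
  assumes cont: "continuous_on UNIV F" and proper: "\<And>r. bounded (F -` cball 0 r)" and C: "closed C"
  shows "closed (F ` C)"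
  unfolding closed_sequential_limits
proof (intro allI impI, elim conjE)
  fix q l assume q: "\<forall>n. q n \<in> F ` C" and lim: "q \<longlonglongrightarrow> l"
  from q have "\<forall>n. \<exists>w. w \<in> C \<and> q n = F w" by blast
  then obtain w where w: "\<And>n. w n \<in> C" "\<And>n. q n = F (w n)"
    by (auto dest!: choice)
  obtain r where "\<And>n. norm (q n) \<le> r"
    using convergent_imp_bounded[OF lim] by (auto simp: bounded_iff)
  then have "range w \<subseteq> F -` cball 0 r" by (auto simp: w(2))
  then have "bounded (range w)" using proper bounded_subset by blast
  then obtain v s where s: "strict_mono s" "(w \<circ> s) \<longlonglongrightarrow> v"
    using bounded_imp_convergent_subsequence by blast
  have v: "v \<in> C"
    using C by (rule closed_sequentially[where f = "w \<circ> s"]) (use w s in auto)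
  have "(\<lambda>n. F ((w \<circ> s) n)) \<longlonglongrightarrow> F v"
    using cont s(2) by (rule continuous_on_tendsto_compose) auto
  moreover have "(\<lambda>n. F ((w \<circ> s) n)) \<longlonglongrightarrow> l"
    using LIMSEQ_subseq_LIMSEQ[OF lim s(1)] by (simp add: w(2) o_def)
  ultimately show "l \<in> F ` C" using v LIMSEQ_unique by blast
qed

text \<open>Properness makes fibres finite and the map closed. Disjoint neighbourhoods of the points
  of a fibre then yield an evenly covered neighbourhood of its image.\<close>

lemma proper_local_homeomorphism_covering:
  fixes F :: "'a::euclidean_space \<Rightarrow> 'a"
  assumes cont: "continuous_on UNIV F" and proper: "\<And>r. bounded (F -` cball 0 r)"
      and local: "\<And>x. \<exists>r>0. inj_on F (ball x r)"
  shows "covering_space UNIV F UNIV"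
proof -
  have cont': "continuous_on S F" for S using cont continuous_on_subset by blast
  have open_map: "open (F ` S)" if "open S" for S
  proof (subst open_subopen, intro ballI)
    fix y assume "y \<in> F ` S"
    then obtain x where x: "x \<in> S" "y = F x" by blast
    obtain r where r: "r > 0" "inj_on F (ball x r)" using local by blast
    have "open (F ` (S \<inter> ball x r))"
      by (rule invariance_of_domain[OF cont']) (use that r in \<open>auto intro: inj_on_subset\<close>)
    then show "\<exists>T. open T \<and> y \<in> T \<and> T \<subseteq> F ` S"
      using x r by (intro exI[of _ "F ` (S \<inter> ball x r)"]) auto
  qed
  have closed_map: "closed (F ` C)" if "closed C" for C
    using cont proper that by (rule proper_imp_closed_map)
  have range: "range F = UNIV"
    using open_map[of UNIV] closed_map[of UNIV] clopen[of "range F"] by auto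
  show ?thesis
    unfolding covering_space_def
  proof (intro conjI ballI cont range)
    fix y
    define T where "T = F -` {y}"
    have "closed T" unfolding T_def using cont by (intro closed_vimage) (auto simp: continuous_on_eq_continuous_at)
    moreover have "bounded T" using proper[of "norm y"] by (rule bounded_subset) (auto simp: T_def)
    ultimately have "compact T" by (simp add: compact_eq_bounded_closed)
    obtain r where r: "\<And>x. r x > 0" "\<And>x. inj_on F (ball x (r x))" using local by metis
    \<comment> \<open>A ball on which F is injective, centred in the fibre, meets the fibre in its
      centre only, so the centres of a finite subcover exhaust it.\<close>
    have "finite T"
    proof -
      obtain T' where T': "T' \<subseteq> T" "finite T'" "T \<subseteq> (\<Union>x\<in>T'. ball x (r x))"
        by (rule compactE_image[OF \<open>compact T\<close>, of T "\<lambda>x. ball x (r x)"]) (use r in auto)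
      have "T \<subseteq> T'"
      proof
        fix x assume "x \<in> T"
        then obtain x' where x': "x' \<in> T'" "x \<in> ball x' (r x')" using T' by blast
        have "x' \<in> T" using x'(1) T'(1) by blast
        with \<open>x \<in> T\<close> have "F x = F x'" by (simp add: T_def)
        moreover have "x' \<in> ball x' (r x')" using r(1) by simp
        ultimately have "x = x'" using inj_onD[OF r(2)] x'(2) by blast
        then show "x \<in> T'" using x' by simp
      qed
      then show ?thesis using T'(2) finite_subset by blast
    qed
    then obtain d where d: "d > 0" "\<And>x x'. x \<in> T \<Longrightarrow> x' \<in> T \<Longrightarrow> x \<noteq> x' \<Longrightarrow> d \<le> dist x x'"
    proof -
      \<comment> \<open>Inserting 1 gives a minimum even if the fibre has fewer than two
        points.\<close>
      define D where "D = insert 1 ((\<lambda>(x, x'). dist x x') ` {(x, x'). x \<in> T \<and> x' \<in> T \<and> x \<noteq> x'})"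
      have "finite {(x, x'). x \<in> T \<and> x' \<in> T \<and> x \<noteq> x'}"
        using \<open>finite T\<close> by (rule_tac finite_subset[of _ "T \<times> T"]) auto
      then have "finite D" "D \<noteq> {}" "\<And>e. e \<in> D \<Longrightarrow> e > 0" by (auto simp: D_def)
      moreover have "Min D \<le> dist x x'" if "x \<in> T" "x' \<in> T" "x \<noteq> x'" for x x'
        using \<open>finite D\<close> that by (intro Min_le) (auto simp: D_def)
      ultimately show thesis using that[of "Min D"] Min_in by metis
    qed
    define V where "V x = ball x (min (r x) (d/2))" for x
    have V: "open (V x)" "x \<in> V x" "inj_on F (V x)" for x
      using r d(1) by (auto simp: V_def intro: inj_on_subset[OF r(2)])
    have disj: "V x \<inter> V x' = {}" if "x \<in> T" "x' \<in> T" "x \<noteq> x'" for x x'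
    proof -
      have "ball x (d/2) \<inter> ball x' (d/2) = {}"
        using d(2)[OF that] by (intro disjoint_ballI) auto
      then show ?thesis by (auto simp: V_def)
    qed
    \<comment> \<open>The first part makes every V x reach all of \<open>W\<close>; the second keeps
      the preimage of \<open>W\<close> inside the union of the V x, and is open because F is
      closed.\<close>
    define W where "W = (\<Inter>x\<in>T. F ` V x) \<inter> - (F ` (- (\<Union>x\<in>T. V x)))"
    have "open W" unfolding W_def
      using V \<open>finite T\<close> by (intro open_Int open_INT ballI open_map open_Compl closed_map closed_Compl open_UN) auto
    have "y \<in> W"
      using V(2) by (auto simp: W_def T_def)
    define \<V> where "\<V> = (\<lambda>x. V x \<inter> F -` W) ` T"
    have openF: "open (F -` W)" using cont \<open>open W\<close> by (simp add: continuous_on_open_vimage)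
    have "\<Union>\<V> = UNIV \<inter> F -` W"
      by (auto simp: \<V>_def W_def)
    moreover have "openin (top_of_set UNIV) u" if "u \<in> \<V>" for u
      using that V(1) openF by (auto simp: \<V>_def)
    moreover have "pairwise disjnt \<V>"
      using disj unfolding pairwise_def \<V>_def disjnt_def by blast
    moreover have "\<exists>q. homeomorphism u W F q" if "u \<in> \<V>" for u
    proof -
      obtain x where x: "x \<in> T" "u = V x \<inter> F -` W" using \<open>u \<in> \<V>\<close> by (auto simp: \<V>_def)
      have "F ` u = F ` V x \<inter> W" unfolding x(2) by blast
      moreover have "W \<subseteq> F ` V x" unfolding W_def using x(1) by blast
      ultimately have "F ` u = W" by blast
      moreover have "open u" using x V(1) openF by auto
      moreover have "inj_on F u" using V(3)[of x] x by (auto intro: inj_on_subset)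
      ultimately show ?thesis
        using invariance_of_domain_homeomorphism[of u F] cont' by (metis order_refl)
    qed
    ultimately show "\<exists>T. y \<in> T \<and> openin (top_of_set UNIV) T \<and>
        (\<exists>v. \<Union>v = UNIV \<inter> F -` T \<and> (\<forall>u\<in>v. openin (top_of_set UNIV) u) \<and>
          pairwise disjnt v \<and> (\<forall>u\<in>v. \<exists>q. homeomorphism u T F q))"
      using \<open>y \<in> W\<close> \<open>open W\<close> by (intro exI[of _ W] conjI exI[of _ \<V>]) auto
  qed
qed

text \<open>A section of the covering through \<open>a\<close> composed with the covering is a lift of the covering itself,
  hence the identity.\<close>

lemma self_covering_inj:
  fixes F :: "'a::euclidean_space \<Rightarrow> 'a"
  assumes cov: "covering_space UNIV F UNIV"
  shows "inj F"
proof (rule injI)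
  fix a b assume ab: "F a = F b"
  have conv: "simply_connected (UNIV :: 'a set)" "locally path_connected (UNIV :: 'a set)"
    by (auto intro: convex_imp_simply_connected convex_imp_locally_path_connected)
  obtain g where g: "continuous_on UNIV g" "g (F a) = a" "\<And>y. F (g y) = y"
    using covering_space_lift_strong[OF cov UNIV_I UNIV_I conv continuous_on_id, of "F a" a] by auto
  have cont: "continuous_on UNIV F" using cov by (rule covering_space_imp_continuous)
  have "(g \<circ> F) x = id x" for x
  proof (rule covering_space_lift_unique[OF cov, of "g \<circ> F" a id UNIV F x])
    show "continuous_on UNIV (g \<circ> F)"
      using cont g(1) by (intro continuous_on_compose) (auto intro: continuous_on_subset)
  qed (use cont g in auto)
  then show "a = b" by (metis ab comp_apply id_apply)
qed

section \<open>Local injectivity and properness of polynomial plane maps\<close>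

lemma has_derivative_eval2:
  "((\<lambda>w. eval2 P (Re w) (Im w)) has_derivative
     (\<lambda>h. eval2 (map_poly pderiv P) (Re w) (Im w) * Re h + eval2 (pderiv P) (Re w) (Im w) * Im h)) (at w)"
proof (induction P)
  case (pCons q P)
  have "((\<lambda>w. poly q (Re w)) has_derivative (\<lambda>h. poly (pderiv q) (Re w) * Re h)) (at w)"
    using has_derivative_compose[OF has_derivative_Re[OF has_derivative_ident], of "poly q" "(*) (poly (pderiv q) (Re w))" w UNIV]
      poly_DERIV[of q "Re w"] by (simp add: has_field_derivative_def)
  then show ?case
    using pCons.IH
    by (auto intro!: derivative_eq_intros simp: map_poly_pCons pderiv_pCons fun_eq_iff algebra_simps)
qed simp

text \<open>An invertible derivative that varies continuously in operator norm gives local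
  injectivity; \<open>D\<close> is a continuous bound for that variation, built from the four
  partial derivatives and zero at \<open>a\<close>.\<close>

lemma planar_locally_injective:
  assumes der: "\<And>w. \<exists>L. (planar P Q has_derivative L) (at w) \<and> inj L"
  shows "\<exists>r>0. inj_on (planar P Q) (ball a r)"
proof -
  define L where "L w h = Complex
      (eval2 (map_poly pderiv P) (Re w) (Im w) * Re h + eval2 (pderiv P) (Re w) (Im w) * Im h)
      (eval2 (map_poly pderiv Q) (Re w) (Im w) * Re h + eval2 (pderiv Q) (Re w) (Im w) * Im h)" for w h
  have L: "(planar P Q has_derivative L w) (at w)" for w
    unfolding planar_def L_def Complex_eq
    by (auto intro!: derivative_eq_intros has_derivative_eval2)
  have "inj (L a)" using der[of a] L[of a] has_derivative_unique by metis
  moreover have "linear (L a)" using L has_derivative_linear by blast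
  ultimately obtain L' where L': "linear L'" "L' \<circ> L a = id"
    using linear_injective_left_inverse by blast
  define D where "D w = \<bar>eval2 (map_poly pderiv P) (Re w) (Im w) - eval2 (map_poly pderiv P) (Re a) (Im a)\<bar>
      + \<bar>eval2 (pderiv P) (Re w) (Im w) - eval2 (pderiv P) (Re a) (Im a)\<bar>
      + \<bar>eval2 (map_poly pderiv Q) (Re w) (Im w) - eval2 (map_poly pderiv Q) (Re a) (Im a)\<bar>
      + \<bar>eval2 (pderiv Q) (Re w) (Im w) - eval2 (pderiv Q) (Re a) (Im a)\<bar>" for w
  have D: "onorm (\<lambda>h. L w h - L a h) \<le> D w" for w
  proof (rule onorm_bound)
    fix h
    have e: "\<bar>u * Re h\<bar> \<le> \<bar>u\<bar> * norm h" "\<bar>u * Im h\<bar> \<le> \<bar>u\<bar> * norm h" for u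
      by (auto simp: abs_mult intro!: mult_left_mono abs_Re_le_cmod abs_Im_le_cmod)
    let ?p = "eval2 (map_poly pderiv P) (Re w) (Im w) - eval2 (map_poly pderiv P) (Re a) (Im a)"
    let ?q = "eval2 (pderiv P) (Re w) (Im w) - eval2 (pderiv P) (Re a) (Im a)"
    let ?r = "eval2 (map_poly pderiv Q) (Re w) (Im w) - eval2 (map_poly pderiv Q) (Re a) (Im a)"
    let ?s = "eval2 (pderiv Q) (Re w) (Im w) - eval2 (pderiv Q) (Re a) (Im a)"
    have "norm (L w h - L a h) \<le> \<bar>Re (L w h - L a h)\<bar> + \<bar>Im (L w h - L a h)\<bar>"
      by (rule cmod_le)
    also have "Re (L w h - L a h) = ?p * Re h + ?q * Im h" by (simp add: L_def algebra_simps)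
    also have "Im (L w h - L a h) = ?r * Re h + ?s * Im h" by (simp add: L_def algebra_simps)
    also have "\<bar>?p * Re h + ?q * Im h\<bar> + \<bar>?r * Re h + ?s * Im h\<bar> \<le>
        (\<bar>?p * Re h\<bar> + \<bar>?q * Im h\<bar>) + (\<bar>?r * Re h\<bar> + \<bar>?s * Im h\<bar>)"
      by (intro add_mono abs_triangle_ineq)
    also have "\<dots> \<le> (\<bar>?p\<bar> * norm h + \<bar>?q\<bar> * norm h) + (\<bar>?r\<bar> * norm h + \<bar>?s\<bar> * norm h)"
      by (intro add_mono e)
    also have "\<dots> = D w * norm h" by (simp add: D_def algebra_simps)
    finally show "norm (L w h - L a h) \<le> D w * norm h" .
  qed (simp add: D_def)
  have "continuous_on UNIV D" unfolding D_def by (intro continuous_intros)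
  then have contD: "isCont D a" by (simp add: continuous_on_eq_continuous_at)
  have "bounded_linear L'" using L'(1) linear_conv_bounded_linear by blast
  then obtain r where "r > 0" "inj_on (planar P Q) (ball a r)"
  proof (rule has_derivative_locally_injective[OF UNIV_I open_UNIV _ L'(2) L])
    fix e :: real assume "e > 0"
    then obtain d where d: "d > 0" "\<And>w. dist w a < d \<Longrightarrow> dist (D w) (D a) < e"
      using contD unfolding continuous_at_eps_delta by blast
    have "onorm (\<lambda>h. L w h - L a h) < e" if "dist a w < d" for w
      using D[of w] d(2)[of w] that by (simp add: D_def dist_commute dist_real_def)
    then show "\<exists>d>0. \<forall>x. dist a x < d \<longrightarrow> onorm (\<lambda>v. L x v - L a v) < e"
      using d(1) by blast
  qed blast
  then show ?thesis by blast
qed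

lemma planar_inj_iff_proper:
  assumes der: "\<And>w. \<exists>L. (planar P Q has_derivative L) (at w) \<and> inj L"
  shows "inj (planar P Q) \<longleftrightarrow> (\<forall>r. bounded (planar P Q -` cball 0 r))"
proof
  let ?K = "planar P Q"
  assume inj: "inj ?K"
  then have surj: "surj ?K" using der by (rule injective_planar_surjective)
  show "\<forall>r. bounded (?K -` cball 0 r)"
  proof
    fix r
    have "continuous_on (range ?K) (inv ?K)"
      by (rule continuous_on_inverse_open) (use inj continuous_on_planar in auto)
    then have "compact (inv ?K ` cball 0 r)"
      by (intro compact_continuous_image) (auto intro: continuous_on_subset simp: surj)
    moreover have "?K -` cball 0 r = inv ?K ` cball 0 r"
      using inj surj by (intro bij_vimage_eq_inv_image bijI)
    ultimately show "bounded (?K -` cball 0 r)" by (simp add: compact_imp_bounded)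
  qed
next
  let ?K = "planar P Q"
  assume "\<forall>r. bounded (?K -` cball 0 r)"
  then have "covering_space UNIV ?K UNIV"
    using planar_locally_injective[OF der]
    by (intro proper_local_homeomorphism_covering continuous_on_planar) auto
  then show "inj ?K" by (rule self_covering_inj)
qed

section \<open>Transfer to vectors of \<open>real^2\<close>\<close>

lemma real_polynomial_function_eval2:
  fixes h :: "real^2 \<Rightarrow> real"
  assumes "real_polynomial_function h"
  shows "\<exists>P. \<forall>p. h p = eval2 P (p $ 1) (p $ 2)"
  using assms
proof (induction h rule: real_polynomial_function.induct)
  case (linear h)
  have "h p = eval2 [:[:0, h (axis 1 1):], [:h (axis 2 1):]:] (p $ 1) (p $ 2)" for p
  proof -
    have "p = p $ 1 *\<^sub>R axis 1 1 + p $ 2 *\<^sub>R axis 2 1"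
      by (simp add: vec_eq_iff forall_2 axis_def)
    then have "h p = h (p $ 1 *\<^sub>R axis 1 1 + p $ 2 *\<^sub>R axis 2 1)" by simp
    also have "\<dots> = p $ 1 * h (axis 1 1) + p $ 2 * h (axis 2 1)"
      using linear by (simp add: bounded_linear.linear linear_add linear_scale)
    finally show ?thesis by simp
  qed
  then show ?case by blast
next
  case (const c)
  show ?case by (intro exI[of _ "[:[:c:]:]"]) simp
next
  case (add h k)
  then obtain P Q where "\<And>p. h p = eval2 P (p $ 1) (p $ 2)" "\<And>p. k p = eval2 Q (p $ 1) (p $ 2)" by blast
  then show ?case by (intro exI[of _ "P + Q"]) simp
next
  case (mult h k)
  then obtain P Q where "\<And>p. h p = eval2 P (p $ 1) (p $ 2)" "\<And>p. k p = eval2 Q (p $ 1) (p $ 2)" by blast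
  then show ?case by (intro exI[of _ "P * Q"]) simp
qed

theorem theorem4:
  fixes F :: "real^2 \<Rightarrow> real^2" and f g I :: "real^2 \<Rightarrow> real"
  assumes F_eq: "\<And>p. F p = vector [f p, g p]"
    and poly: "polynomial_function F"
    and jac: "\<And>p. det (jacobian F (at p)) \<noteq> 0"
    and zero: "F 0 = 0"
    and I_eq: "\<And>p. I p = (f p)\<^sup>2 + (g p)\<^sup>2"
  shows "inj F \<longleftrightarrow> filterlim I at_top (filtercomap (\<lambda>p. \<bar>p $ 1\<bar> + \<bar>p $ 2\<bar>) at_top)"
proof -
  have comp: "F p $ 1 = f p" "F p $ 2 = g p" for p
    by (simp_all add: F_eq)
  have "real_polynomial_function (\<lambda>p. F p $ i)" for i
    using poly bounded_linear_vec_nth[of i] unfolding polynomial_function_def by (auto simp: o_def)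
  from this[of 1] this[of 2] obtain P Q
    where P: "\<And>p. f p = eval2 P (p $ 1) (p $ 2)" and Q: "\<And>p. g p = eval2 Q (p $ 1) (p $ 2)"
    using real_polynomial_function_eval2 by (metis (no_types, lifting) comp)
  \<comment> \<open>Conjugation by these mutually inverse linear maps turns \<open>F\<close> into
    \<open>planar P Q\<close> and the nonzero Jacobian into injectivity of the derivative.\<close>
  define toV :: "complex \<Rightarrow> real^2" where "toV w = vector [Re w, Im w]" for w
  define toC :: "real^2 \<Rightarrow> complex" where "toC p = Complex (p $ 1) (p $ 2)" for p
  have toC_toV [simp]: "toC (toV w) = w" for w by (simp add: toC_def toV_def)
  have toV_toC [simp]: "toV (toC p) = p" for p by (simp add: toC_def toV_def vec_eq_iff forall_2)
  have "linear toC" "linear toV"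
    by (auto intro!: linearI simp: toC_def toV_def vec_eq_iff forall_2 complex_eq_iff)
  then have blin: "bounded_linear toC" "bounded_linear toV"
    by (simp_all add: linear_conv_bounded_linear)
  have inj_toC: "inj toC" and inj_toV: "inj toV"
    by (rule inj_on_inverseI[where g = toV], simp, rule inj_on_inverseI[where g = toC], simp)
  let ?K = "planar P Q"
  have K: "?K w = toC (F (toV w))" for w
    by (simp add: planar_def toC_def comp P Q) (simp add: toV_def)
  have der: "\<exists>L. (?K has_derivative L) (at w) \<and> inj L" for w
  proof -
    let ?J = "jacobian F (at (toV w))"
    have "(F has_derivative (\<lambda>h. ?J *v h)) (at (toV w))"
      using differentiable_at_polynomial_function[OF poly] jacobian_works by blast
    then have "((\<lambda>w. F (toV w)) has_derivative (\<lambda>h. ?J *v toV h)) (at w)"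
      by (rule has_derivative_compose[OF bounded_linear_imp_has_derivative[OF blin(2)]])
    then have "((\<lambda>w. toC (F (toV w))) has_derivative (\<lambda>h. toC (?J *v toV h))) (at w)"
      by (rule bounded_linear.has_derivative[OF blin(1)])
    then have "(?K has_derivative (\<lambda>h. toC (?J *v toV h))) (at w)"
      unfolding K[abs_def, symmetric] by simp
    moreover have "inj ((*v) ?J)"
      using jac by (intro inj_matrix_vector_mult) (simp add: invertible_det_nz)
    then have "inj (\<lambda>h. toC (?J *v toV h))"
      using inj_compose[OF inj_toC inj_compose[OF _ inj_toV]] by (simp add: comp_def)
    ultimately show ?thesis by blast
  qed
  have "inj F \<longleftrightarrow> inj ?K"
  proof
    assume "inj F"
    then show "inj ?K" 
      unfolding K[abs_def] using inj_compose[OF inj_toC inj_compose[OF _ inj_toV]] by (simp add: comp_def)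
  next
    assume inj: "inj ?K"
    show "inj F"
    proof (rule injI)
      fix p q assume "F p = F q"
      then have "?K (toC p) = ?K (toC q)" by (simp add: K)
      then have "toC p = toC q" by (rule injD[OF inj])
      then show "p = q" by (rule injD[OF inj_toC])
    qed
  qed
  also have "\<dots> \<longleftrightarrow> (\<forall>r. bounded (?K -` cball 0 r))"
    using der by (rule planar_inj_iff_proper)
  also have "\<dots> \<longleftrightarrow> filterlim I at_top (filtercomap (\<lambda>p. \<bar>p $ 1\<bar> + \<bar>p $ 2\<bar>) at_top)"
  proof -
    have I: "I p = (cmod (?K (toC p)))\<^sup>2" for p
      by (simp add: I_eq K toC_def[of "F p"] comp cmod_power2)
    have abs: "\<bar>toV w $ 1\<bar> = \<bar>Re w\<bar>" "\<bar>toV w $ 2\<bar> = \<bar>Im w\<bar>" for w by (simp_all add: toV_def)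
    show ?thesis
      unfolding filterlim_at_top eventually_filtercomap_at_top_linorder
    proof (intro iffI allI)
      fix Z assume proper: "\<forall>r. bounded (?K -` cball 0 r)"
      \<comment> \<open>The absolute value covers negative \<open>Z\<close>, and the square of r is
        then at least \<open>Z\<close>.\<close>
      define r where "r = sqrt \<bar>Z\<bar>"
      obtain B where "\<forall>w\<in>?K -` cball 0 r. cmod w \<le> B"
        using proper unfolding bounded_iff by blast
      then have B: "cmod w \<le> B" if "cmod (?K w) \<le> r" for w using that by simp
      \<comment> \<open>The sum of the absolute coordinates is at most twice the modulus, so the
        bound 2 B + 1 forces a modulus above \<open>B\<close>.\<close>
      have "Z \<le> I p" if "\<bar>p $ 1\<bar> + \<bar>p $ 2\<bar> \<ge> 2 * B + 1" for p :: "real^2"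
      proof -
        have "\<not> cmod (toC p) \<le> B"
          using that abs_Re_le_cmod[of "toC p"] abs_Im_le_cmod[of "toC p"] by (simp add: toC_def)
        then have "cmod (?K (toC p)) \<ge> r" using B[of "toC p"] by linarith
        then have "r\<^sup>2 \<le> I p" unfolding I by (intro power_mono) (simp_all add: r_def)
        then show ?thesis by (simp add: r_def)
      qed
      then show "\<exists>N. \<forall>p. N \<le> \<bar>p $ 1\<bar> + \<bar>p $ 2\<bar> \<longrightarrow> Z \<le> I p" by blast
    next
      fix r
      assume "\<forall>Z. \<exists>N. \<forall>p. N \<le> \<bar>p $ 1\<bar> + \<bar>p $ 2\<bar> \<longrightarrow> Z \<le> I p"
      \<comment> \<open>The added 1 makes the bound on \<open>I\<close> strictly exceed the squared
        radius of the ball.\<close>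
      then obtain N where N: "\<And>p. N \<le> \<bar>p $ 1\<bar> + \<bar>p $ 2\<bar> \<Longrightarrow> r\<^sup>2 + 1 \<le> I p" by blast
      have "cmod w \<le> N" if "w \<in> ?K -` cball 0 r" for w
      proof (rule ccontr)
        assume "\<not> cmod w \<le> N"
        then have "N \<le> \<bar>toV w $ 1\<bar> + \<bar>toV w $ 2\<bar>" using cmod_le[of w] by (simp add: abs)
        then have "r\<^sup>2 + 1 \<le> (cmod (?K w))\<^sup>2" using N[of "toV w"] I[of "toV w"] by simp
        moreover have "(cmod (?K w))\<^sup>2 \<le> r\<^sup>2" using that by (intro power_mono) auto
        ultimately show False by simp
      qed
      then show "bounded (?K -` cball 0 r)" unfolding bounded_iff by blast
    qed
  qed
  finally show ?thesis .
qed

end
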